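(* Let $k \geq 3$ and let $\mathbb{A} = \{a_1, a_2, \ldots, a_k\}_{\vec r}$ be a sequence of positive integers with $a_1 < a_2 < \cdots < a_k$, $\vec r = (r_1, \ldots, r_k)$ and $r_i \geq 2$ for all $i \in [1,k]$. Let $A = \{a_1,\ldots,a_k\}$, $r = \min\{r_1,\ldots,r_k\}$, and suppose $d(A)=1$. Let $\alpha < \sum_{i=1}^k r_i - r$ be a positive integer. Then there exists an integer $m \in [1,k]$ such that $\sum_{i=1}^{m-1} r_i \leq \alpha < \sum_{i=1}^m r_i$ and \[ |S_\alpha(\mathbb{A})| \geq |(r-1)(A\cup\{0\})| + \min\{a_k, r(k-1)+1\} + \sum_{i=1}^{k-1} i r_i - \sum_{i=1}^m i r_i + m\Big(\sum_{i=1}^m r_i - \alpha\Big) + k(r_k - r). \]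
   Context: The notation $\mathbb{A} = \{a_1, \ldots, a_k\}_{\vec r}$ with $\vec r = (r_1,\ldots,r_k)$ means $\mathbb{A}$ is a finite sequence consisting of the $k$ distinct integers $a_1,\ldots,a_k$, where $a_i$ appears exactly $r_i$ times. For a positive integer $\alpha$, $S_\alpha(\mathbb{A}) = \{\sum_{b\in\mathbb{B}} b : \mathbb{B} \text{ a subsequence of } \mathbb{A},\ |\mathbb{B}| \geq \alpha\}$, where $|\mathbb{B}|$ counts terms with multiplicity. For a finite set $X$ of integers and $h\ge1$, $hX$ is the $h$-fold sumset (all sums of $h$ not necessarily distinct elements of $X$). $d(A)$ is the gcd of the elements of $A$. Empty sums are $0$. *)

theory Defs
  imports Complex_Main "HOL-Library.Sublist"
begin

text \<open>
  \<open>seq_with_mult k a rs xs\<close> says that \<open>xs\<close> is a sequence \<open>{a 1, \<dots>, a k}\<close> with multiplicity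
  vector \<open>(rs 1, \<dots>, rs k)\<close>. The notation leaves the order of the terms open, so this is
  a property of a list rather than a definition of one.
\<close>
definition seq_with_mult :: "nat \<Rightarrow> (nat \<Rightarrow> int) \<Rightarrow> (nat \<Rightarrow> nat) \<Rightarrow> int list \<Rightarrow> bool" where
  "seq_with_mult k a rs xs \<longleftrightarrow>
     inj_on a {1..k} \<and> set xs = a ` {1..k} \<and> (\<forall>i\<in>{1..k}. count_list xs (a i) = rs i)"

definition subseq_sums :: "nat \<Rightarrow> int list \<Rightarrow> int set" where
  "subseq_sums \<alpha> xs = {sum_list ys | ys. subseq ys xs \<and> length ys \<ge> \<alpha>}"

definition hfold_sumset :: "nat \<Rightarrow> int set \<Rightarrow> int set" where
  "hfold_sumset h X = {sum_list xs | xs. length xs = h \<and> set xs \<subseteq> X}"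

end

theory Submission
  imports Defs "HOL-Library.Set_Algebras"
begin

text \<open>
  Passing to complements, \<open>S\<^sub>\<alpha>\<close> has as many elements as there are sums of at most
  \<open>\<Sum> r\<^sub>i - \<alpha>\<close> terms. Among these are the \<open>r\<close>-fold sums of \<open>A \<union> {0}\<close>, none exceeding
  \<open>r a\<^sub>k\<close>, and above \<open>r a\<^sub>k\<close> an explicit increasing chain accounts for the linear terms of the bound.
  What remains is Lev's inequality \<open>|hA| \<ge> |(h-1)A| + min l (h(n-2)+1)\<close> for \<open>A \<subseteq> [0,l]\<close>
  with \<open>n\<close> elements, \<open>0, l \<in> A\<close> and gcd 1. Every residue modulo \<open>l\<close> met by \<open>hA\<close> contributes an
  element outside \<open>(h-1)A\<close>. Instead of Kneser's theorem, Mann's theorem is used: take the least divisor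
  \<open>d\<close> of \<open>l\<close> such that \<open>A\<close> misses a class modulo \<open>d\<close> and, modulo \<open>l\<close>, fills the classes it meets
  up to fewer than \<open>l/d\<close> residues.
  Modulo this \<open>d\<close> the sumsets \<open>hA\<close> grow as in a torsion-free group, all classes modulo \<open>d\<close> but at most
  one are met completely, and one class reached only with \<open>h\<close> summands contributes the rest.
\<close>

section \<open>Counting residues\<close>

definition residue_count :: "int \<Rightarrow> int set \<Rightarrow> nat" where
  "residue_count d X = card ((\<lambda>x. x mod d) ` X)"

text \<open>Subsets of the integers modulo \<open>d\<close> are represented by
  \<open>d\<close>-periodic sets of integers: sumsets stay those of the integers, and different
  moduli can be compared.\<close>

definition periodic :: "int \<Rightarrow> int set \<Rightarrow> bool" where
  "periodic d X \<longleftrightarrow> (\<forall>x y. x mod d = y mod d \<longrightarrow> x \<in> X \<longrightarrow> y \<in> X)"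

text \<open>This is the preimage in the integers of the image of \<open>X\<close> modulo
  \<open>d\<close>.\<close>

definition residue_hull :: "int \<Rightarrow> int set \<Rightarrow> int set" where
  "residue_hull d X = {y. \<exists>x\<in>X. x mod d = y mod d}"

lemma finite_residues:
  assumes "d > 0"
  shows "finite ((\<lambda>x::int. x mod d) ` X)"
proof (rule finite_subset)
  show "(\<lambda>x. x mod d) ` X \<subseteq> {0..<d}" using assms by auto
qed simp

lemma residue_count_le:
  assumes "d > 0"
  shows "int (residue_count d X) \<le> d"
proof -
  have "card ((\<lambda>x. x mod d) ` X) \<le> card {0..<d}"
    using assms by (intro card_mono) auto
  then show ?thesis using assms by (simp add: residue_count_def)
qed

lemma residue_count_mono: "d > 0 \<Longrightarrow> X \<subseteq> Y \<Longrightarrow> residue_count d X \<le> residue_count d Y"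
  unfolding residue_count_def by (intro card_mono finite_residues image_mono)

lemma residue_count_pos: "d > 0 \<Longrightarrow> X \<noteq> {} \<Longrightarrow> residue_count d X > 0"
  unfolding residue_count_def by (simp add: card_gt_0_iff finite_residues)

lemma residue_count_translate:
  assumes "d > 0"
  shows "residue_count d ((\<lambda>x. x + t) ` X) = residue_count d X"
proof -
  have le: "residue_count d ((\<lambda>x. x + s) ` Y) \<le> residue_count d Y" for s Y
  proof -
    have "(\<lambda>x. x mod d) ` (\<lambda>x. x + s) ` Y = (\<lambda>x. (x + s) mod d) ` (\<lambda>x. x mod d) ` Y"
      by (simp add: image_image mod_add_left_eq)
    then show ?thesis
      unfolding residue_count_def using card_image_le[OF finite_residues[OF assms]] by metis
  qed
  have "(\<lambda>x. x + (- t)) ` (\<lambda>x. x + t) ` X = X" by (simp add: image_image)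
  then show ?thesis using le[of t X] le[of "- t" "(\<lambda>x. x + t) ` X"] by simp
qed

lemma residue_count_uminus:
  assumes "d > 0"
  shows "residue_count d (uminus ` X) = residue_count d X"
proof -
  have le: "residue_count d (uminus ` Y) \<le> residue_count d Y" for Y
  proof -
    have "(\<lambda>x. x mod d) ` uminus ` Y = (\<lambda>x. (- x) mod d) ` (\<lambda>x. x mod d) ` Y"
      by (simp add: image_image mod_minus_eq)
    then show ?thesis
      unfolding residue_count_def using card_image_le[OF finite_residues[OF assms]] by metis
  qed
  have "uminus ` uminus ` X = X" by (simp add: image_image)
  then show ?thesis using le[of X] le[of "uminus ` X"] by simp
qed

lemma residue_count_hull: "residue_count d (residue_hull d X) = residue_count d X"
proof -
  have "(\<lambda>x. x mod d) ` residue_hull d X = (\<lambda>x. x mod d) ` X"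
    unfolding residue_hull_def by (auto simp: image_iff) metis
  then show ?thesis by (simp add: residue_count_def)
qed

lemma periodic_hull: "periodic d (residue_hull d X)"
  unfolding periodic_def residue_hull_def by auto

lemma subset_hull: "X \<subseteq> residue_hull d X"
  unfolding residue_hull_def by auto

text \<open>Adding multiples of \<open>d\<close> commutes with adding \<open>B\<close>, so one
  periodic summand makes the whole sumset periodic.\<close>

lemma hull_plus: "residue_hull d X + B = residue_hull d (X + B)"
proof (intro equalityI subsetI)
  fix z assume "z \<in> residue_hull d X + B"
  then obtain y b x where "x \<in> X" "x mod d = y mod d" "b \<in> B" "z = y + b"
    by (auto simp: set_plus_def residue_hull_def)
  then have "(x + b) mod d = z mod d" by (metis mod_add_cong)
  with \<open>x \<in> X\<close> \<open>b \<in> B\<close> show "z \<in> residue_hull d (X + B)"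
    unfolding residue_hull_def by (auto intro: set_plus_intro)
next
  fix z assume "z \<in> residue_hull d (X + B)"
  then obtain x b where *: "x \<in> X" "b \<in> B" "(x + b) mod d = z mod d"
    by (auto simp: set_plus_def residue_hull_def)
  have "(x + b - b) mod d = (z - b) mod d" using *(3) by (rule mod_diff_cong) simp
  then have "z - b \<in> residue_hull d X" using * unfolding residue_hull_def by auto
  then have "(z - b) + b \<in> residue_hull d X + B" using * by (intro set_plus_intro)
  then show "z \<in> residue_hull d X + B" by simp
qed

lemma periodic_eq_hull: "periodic d X \<Longrightarrow> residue_hull d X = X"
  unfolding periodic_def residue_hull_def by auto

lemma periodic_plus: "periodic d X \<Longrightarrow> periodic d (X + B)"
  by (metis hull_plus periodic_eq_hull periodic_hull)

lemma periodic_Un: "periodic d X \<Longrightarrow> periodic d Y \<Longrightarrow> periodic d (X \<union> Y)"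
  and periodic_Int: "periodic d X \<Longrightarrow> periodic d Y \<Longrightarrow> periodic d (X \<inter> Y)"
  unfolding periodic_def by blast+

lemma periodic_Compl: "periodic d X \<Longrightarrow> periodic d (- X)"
  unfolding periodic_def by (metis ComplD ComplI)

lemma periodic_uminus: "periodic d X \<Longrightarrow> periodic d (uminus ` X)"
  unfolding periodic_def by (auto simp: image_iff) (metis mod_minus_cong add.inverse_inverse)

lemma periodic_translate:
  assumes "periodic d X"
  shows "periodic d ((\<lambda>x. x + t) ` X)"
proof -
  have "(\<lambda>x. x + t) ` X = X + {t}" by (auto simp: set_plus_def)
  then show ?thesis using assms periodic_plus by simp
qed

lemma periodic_dvd: "periodic d' X \<Longrightarrow> d' dvd d \<Longrightarrow> periodic d X"
  unfolding periodic_def by (metis mod_mod_cancel)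

lemma residue_count_periodic:
  assumes "d > 0" "periodic d X"
  shows "residue_count d X = card (X \<inter> {0..<d})"
proof -
  have "(\<lambda>x. x mod d) ` X = X \<inter> {0..<d}"
  proof (intro equalityI subsetI)
    fix y assume "y \<in> (\<lambda>x. x mod d) ` X"
    then obtain x where "x \<in> X" "y = x mod d" by auto
    moreover have "x mod d = y mod d" using \<open>y = x mod d\<close> by simp
    ultimately show "y \<in> X \<inter> {0..<d}" using assms unfolding periodic_def by fastforce
  next
    fix y assume "y \<in> X \<inter> {0..<d}"
    then show "y \<in> (\<lambda>x. x mod d) ` X" by (intro image_eqI[of _ _ y]) auto
  qed
  then show ?thesis by (simp add: residue_count_def)
qed

lemma residue_count_Un_Int:
  assumes "d > 0" "periodic d X" "periodic d Y"
  shows "residue_count d (X \<union> Y) + residue_count d (X \<inter> Y) = residue_count d X + residue_count d Y"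
proof -
  have "card ((X \<inter> {0..<d}) \<union> (Y \<inter> {0..<d})) + card ((X \<inter> {0..<d}) \<inter> (Y \<inter> {0..<d}))
      = card (X \<inter> {0..<d}) + card (Y \<inter> {0..<d})"
    by (intro card_Un_Int[symmetric]) auto
  moreover have "(X \<inter> {0..<d}) \<union> (Y \<inter> {0..<d}) = (X \<union> Y) \<inter> {0..<d}"
    "(X \<inter> {0..<d}) \<inter> (Y \<inter> {0..<d}) = (X \<inter> Y) \<inter> {0..<d}" by auto
  ultimately show ?thesis
    using assms by (simp add: residue_count_periodic periodic_Un periodic_Int)
qed

lemma residue_count_Compl:
  assumes "d > 0" "periodic d X"
  shows "int (residue_count d (- X)) = d - int (residue_count d X)"
proof -
  have "residue_count d (X \<union> - X) + residue_count d (X \<inter> - X)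
      = residue_count d X + residue_count d (- X)"
    using assms by (intro residue_count_Un_Int periodic_Compl)
  moreover have "int (residue_count d UNIV) = d"
    using assms residue_count_periodic[of d UNIV] by (simp add: periodic_def)
  moreover have "residue_count d {} = 0" by (simp add: residue_count_def)
  ultimately show ?thesis by simp
qed

lemma periodic_subset_eq:
  assumes "d > 0" "periodic d X" "periodic d Y" "X \<subseteq> Y" "residue_count d Y \<le> residue_count d X"
  shows "X = Y"
proof -
  have "X \<inter> {0..<d} = Y \<inter> {0..<d}"
    using assms by (intro card_seteq) (auto simp: residue_count_periodic)
  then have "y mod d \<in> X" if "y \<in> Y" for y
    using that assms(1,3) unfolding periodic_def
    by (metis IntD1 IntI atLeastLessThan_iff mod_mod_trivial pos_mod_bound pos_mod_sign)
  then have "Y \<subseteq> X" using assms(2) unfolding periodic_def by (metis mod_mod_trivial subsetI)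
  with assms show ?thesis by auto
qed

section \<open>Residue classes under a change of modulus\<close>

lemma card_residue_class:
  fixes d q c :: int
  assumes "d > 0" "q \<ge> 0" "0 \<le> c" "c < d"
  shows "int (card {x \<in> {0..<d * q}. x mod d = c}) = q"
proof -
  have "{x \<in> {0..<d * q}. x mod d = c} = (\<lambda>i. c + d * i) ` {0..<q}"
  proof (intro equalityI subsetI)
    fix x assume x: "x \<in> {x \<in> {0..<d * q}. x mod d = c}"
    then have "x = c + d * (x div d)" by (metis (mono_tags) mem_Collect_eq mod_mult_div_eq)
    moreover have "x div d \<in> {0..<q}"
    proof -
      have "x < d * q" using x by simp
      then have "d * (x div d) < d * q" using \<open>x = c + d * (x div d)\<close> assms(3) by linarith
      then have "x div d < q" using assms by (simp add: mult_less_cancel_left)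
      then show ?thesis using x assms by (auto simp: pos_imp_zdiv_nonneg_iff)
    qed
    ultimately show "x \<in> (\<lambda>i. c + d * i) ` {0..<q}" by blast
  next
    fix x assume "x \<in> (\<lambda>i. c + d * i) ` {0..<q}"
    then obtain i where i: "0 \<le> i" "i \<le> q - 1" "x = c + d * i" by auto
    have "d * i \<le> d * (q - 1)" using i assms by (intro mult_left_mono) auto
    then have "x < d * q" using i assms by (simp add: algebra_simps)
    moreover have "0 \<le> x" using i assms by simp
    ultimately show "x \<in> {x \<in> {0..<d * q}. x mod d = c}" using i assms by auto
  qed
  moreover have "inj_on (\<lambda>i. c + d * i) {0..<q}" using assms by (auto simp: inj_on_def)
  ultimately show ?thesis using assms by (simp add: card_image)
qed

text \<open>Each class modulo \<open>d'\<close> splits into \<open>d div d'\<close> classes modulo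
  \<open>d\<close>, and a \<open>d'\<close>-periodic set contains all or none of them.\<close>

lemma residue_count_coarser:
  assumes "d' > 0" "d > 0" "d' dvd d" "periodic d' X"
  shows "int (residue_count d X) = (d div d') * int (residue_count d' X)"
proof -
  define q where "q = d div d'"
  have d: "d = d' * q" using assms by (simp add: q_def)
  have q: "q > 0" using assms(1,2) d by (simp add: zero_less_mult_iff)
  let ?C = "\<lambda>c. {x \<in> {0..<d' * q}. x mod d' = c}"
  have "X \<inter> {0..<d} = (\<Union>c\<in>X \<inter> {0..<d'}. ?C c)"
  proof (intro equalityI subsetI)
    fix x assume x: "x \<in> X \<inter> {0..<d}"
    then have "x mod d' \<in> X" using assms(4) unfolding periodic_def by (metis IntD1 mod_mod_trivial)
    then show "x \<in> (\<Union>c\<in>X \<inter> {0..<d'}. ?C c)" using x assms(1) d by auto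
  next
    fix x assume "x \<in> (\<Union>c\<in>X \<inter> {0..<d'}. ?C c)"
    then have "x mod d' \<in> X" "x \<in> {0..<d}" using d by auto
    then show "x \<in> X \<inter> {0..<d}" using assms(4) unfolding periodic_def by (metis IntI mod_mod_trivial)
  qed
  moreover have "card (\<Union>c\<in>X \<inter> {0..<d'}. ?C c) = (\<Sum>c\<in>X \<inter> {0..<d'}. card (?C c))"
    by (intro card_UN_disjoint) (auto intro: finite_subset[of _ "{0..<d' * q}"])
  ultimately have "card (X \<inter> {0..<d}) = (\<Sum>c\<in>X \<inter> {0..<d'}. card (?C c))" by simp
  then have "int (card (X \<inter> {0..<d})) = (\<Sum>c\<in>X \<inter> {0..<d'}. int (card (?C c)))" by simp
  also have "\<dots> = (\<Sum>c\<in>X \<inter> {0..<d'}. q)"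
    using assms(1) q by (intro sum.cong refl card_residue_class) auto
  finally show ?thesis
    using assms by (simp add: residue_count_periodic periodic_dvd[OF assms(4,3)] q_def)
qed

section \<open>Mann's theorem\<close>

text \<open>The least positive element generates \<open>F\<close>, by division with
  remainder.\<close>

lemma subgroup_eq_multiples:
  fixes F :: "int set"
  assumes diff: "\<And>x y. x \<in> F \<Longrightarrow> y \<in> F \<Longrightarrow> x - y \<in> F" and d: "d \<in> F" "d > 0"
  obtains e where "e > 0" "e dvd d" "F = {x. e dvd x}"
proof -
  have zero: "0 \<in> F" using diff[OF d(1) d(1)] by simp
  have add: "x + y \<in> F" if "x \<in> F" "y \<in> F" for x y
    using diff[OF that(1) diff[OF zero that(2)]] by simp
  have nmult: "int n * x \<in> F" if "x \<in> F" for n x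
    by (induction n) (auto simp: zero algebra_simps intro: add that)
  have mult: "m * x \<in> F" if "x \<in> F" for m x
  proof (cases "m \<ge> 0")
    case True
    then show ?thesis using nmult[OF that, of "nat m"] by simp
  next
    case False
    then show ?thesis using diff[OF zero nmult[OF that, of "nat (- m)"]] by simp
  qed
  define n where "n = (LEAST n. n > 0 \<and> int n \<in> F)"
  have "nat d > 0 \<and> int (nat d) \<in> F" using d by simp
  then have n: "n > 0 \<and> int n \<in> F" unfolding n_def by (rule LeastI)
  have min: "n \<le> n'" if "n' > 0" "int n' \<in> F" for n'
    unfolding n_def using that by (intro Least_le) simp
  have dvd: "int n dvd x" if "x \<in> F" for x
  proof (rule ccontr)
    assume "\<not> int n dvd x"
    then have "x mod int n \<noteq> 0" by (simp add: dvd_eq_mod_eq_0)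
    moreover have "x mod int n \<ge> 0" using n by simp
    ultimately have pos: "x mod int n > 0" by linarith
    have "x - (x div int n) * int n \<in> F" using that n mult diff by blast
    then have "x mod int n \<in> F" by (simp add: minus_div_mult_eq_mod)
    then have "n \<le> nat (x mod int n)" using pos by (intro min) auto
    moreover have "x mod int n < int n" using n by simp
    ultimately show False using pos by linarith
  qed
  have "F = {x. int n dvd x}"
  proof (intro equalityI subsetI)
    fix x assume "x \<in> {x. int n dvd x}"
    then obtain m where "x = int n * m" by (auto elim: dvdE)
    then show "x \<in> F" using mult[of "int n" m] n by (simp add: mult.commute)
  qed (use dvd in auto)
  moreover have "int n > 0" using n by simp
  ultimately show thesis using that dvd[OF d(1)] by blast
qed

text \<open>
  Mann's theorem for cyclic groups, by Hamidoune's isoperimetric method: among the periodic sets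
  \<open>X \<noteq> {}\<close> with \<open>X + B\<close> not everything, one minimising first \<open>|X + B| - |X|\<close> and then \<open>|X|\<close> has pairwise
  disjoint distinct translates, hence is a coset of a subgroup.
\<close>
lemma Mann_cyclic:
  fixes d :: int
  assumes d: "d > 0" and ne: "X \<noteq> {}" "B \<noteq> {}"
    and lt: "int (residue_count d (X + B)) < d"
    and small: "residue_count d (X + B) + 1 < residue_count d X + residue_count d B"
  obtains e where "e > 0" "e dvd d" "int (residue_count e B) < e"
    "(d div e) * int (residue_count e B) + 1 < d div e + int (residue_count d B)"
proof -
  define \<nu> where "\<nu> = (\<lambda>X. int (residue_count d X))"
  define \<F> where "\<F> = {Y. periodic d Y \<and> Y \<noteq> {} \<and> \<nu> (Y + B) < d}"
  define f where "f = (\<lambda>Y. \<nu> (Y + B) - \<nu> Y)"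
  have \<nu>_mono: "\<nu> Y \<le> \<nu> Z" if "Y \<subseteq> Z" for Y Z
    using that residue_count_mono[OF d] by (simp add: \<nu>_def)
  have f_nonneg: "f Y \<ge> 0" for Y
  proof -
    obtain b where "b \<in> B" using ne by auto
    then have "\<nu> ((\<lambda>y. y + b) ` Y) \<le> \<nu> (Y + B)" by (intro \<nu>_mono) (auto intro: set_plus_intro)
    then show ?thesis by (simp add: f_def \<nu>_def residue_count_translate[OF d])
  qed
  define X' where "X' = residue_hull d X"
  \<comment> \<open>The hull of \<open>X\<close> is admissible, and \<open>small\<close> says
    exactly that its \<open>f\<close> is below \<open>\<nu> B - 1\<close>; hence so is the minimum
    \<open>\<kappa>\<close>.\<close>
  have X': "X' \<in> \<F>" "f X' < \<nu> B - 1"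
    using ne lt small subset_hull[of X d] periodic_hull[of d X]
    by (auto simp: X'_def \<F>_def f_def \<nu>_def hull_plus residue_count_hull)
  \<comment> \<open>\<open>nat\<close> loses nothing because \<open>f\<close> is
    nonnegative.\<close>
  obtain F1 where F1: "F1 \<in> \<F>" "\<And>Y. Y \<in> \<F> \<Longrightarrow> nat (f F1) \<le> nat (f Y)"
    using ex_has_least_nat[of "\<lambda>Y. Y \<in> \<F>" X' "\<lambda>Y. nat (f Y)"] X'(1) by blast
  define \<kappa> where "\<kappa> = f F1"
  have \<kappa>_le: "\<kappa> \<le> f Y" if "Y \<in> \<F>" for Y
    using F1(2)[OF that] f_nonneg[of F1] f_nonneg[of Y] unfolding \<kappa>_def by linarith
  obtain F2 where F2: "F2 \<in> \<F>" "f F2 = \<kappa>"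
    and F2_min: "\<And>Y. Y \<in> \<F> \<Longrightarrow> f Y = \<kappa> \<Longrightarrow> residue_count d F2 \<le> residue_count d Y"
    using ex_has_least_nat[of "\<lambda>Y. Y \<in> \<F> \<and> f Y = \<kappa>" F1 "residue_count d"] F1(1) \<kappa>_def by blast
  have translate: "(\<lambda>x. x + t) ` Y \<in> \<F>" "f ((\<lambda>x. x + t) ` Y) = f Y" "\<nu> ((\<lambda>x. x + t) ` Y) = \<nu> Y"
    if "Y \<in> \<F>" for Y t
  proof -
    have "(\<lambda>x. x + t) ` Y + B = (\<lambda>x. x + t) ` (Y + B)"
    proof -
      have "(\<lambda>x. x + t) ` Z = Z + {t}" for Z by (auto simp: set_plus_def)
      then show ?thesis by (simp add: ac_simps)
    qed
    then show "(\<lambda>x. x + t) ` Y \<in> \<F>" "f ((\<lambda>x. x + t) ` Y) = f Y" "\<nu> ((\<lambda>x. x + t) ` Y) = \<nu> Y"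
      using that by (auto simp: \<F>_def f_def \<nu>_def residue_count_translate[OF d] periodic_translate)
  qed
  \<comment> \<open>Moving 0 into the minimiser makes the coset a subgroup.\<close>
  obtain x0 where "x0 \<in> F2" using F2(1) by (auto simp: \<F>_def)
  define F where "F = (\<lambda>x. x + (- x0)) ` F2"
  have F: "F \<in> \<F>" "f F = \<kappa>" and \<nu>F: "\<nu> F = \<nu> F2" unfolding F_def using translate[OF F2(1)] F2(2) by blast+
  have F0: "0 \<in> F" using \<open>x0 \<in> F2\<close> by (auto simp: F_def image_iff intro!: bexI[of _ x0])
  have F_min: "\<nu> F \<le> \<nu> Y" if "Y \<in> \<F>" "f Y = \<kappa>" for Y
    using F2_min[OF that] \<nu>F by (simp add: \<nu>_def)
  have perF: "periodic d F" using F by (simp add: \<F>_def)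
  have F_pos: "\<nu> F > 0" using F0 residue_count_pos[OF d, of F] by (auto simp: \<nu>_def)
  \<comment> \<open>The complement of \<open>F + B\<close>, reflected, is again extremal: it is extremal for \<open>- B\<close>.\<close>
  have co_atom: "\<nu> F \<le> d - \<nu> (F + B)"
  proof -
    define Y where "Y = uminus ` (- (F + B))"
    have per: "periodic d Y" unfolding Y_def by (intro periodic_uminus periodic_Compl periodic_plus perF)
    have \<nu>Y: "\<nu> Y = d - \<nu> (F + B)"
      unfolding Y_def \<nu>_def
      using residue_count_Compl[OF d periodic_plus[OF perF]] residue_count_uminus[OF d] by simp
    have "\<nu> Y > 0" using \<nu>Y F(1) by (simp add: \<F>_def)
    then have "Y \<noteq> {}" by (auto simp: \<nu>_def residue_count_def)
    have "Y + B \<subseteq> uminus ` (- F)"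
    proof
      fix z assume "z \<in> Y + B"
      then obtain w b where w: "w \<notin> F + B" "b \<in> B" "z = - w + b"
        unfolding Y_def by (elim set_plus_elim) auto
      have "w - b \<notin> F" using w set_plus_intro[of "w - b" F b B] by auto
      then show "z \<in> uminus ` (- F)" using w by (intro image_eqI[of _ _ "w - b"]) auto
    qed
    then have "\<nu> (Y + B) \<le> \<nu> (uminus ` (- F))" by (rule \<nu>_mono)
    also have "\<dots> = d - \<nu> F"
      unfolding \<nu>_def using residue_count_Compl[OF d perF] residue_count_uminus[OF d] by simp
    finally have le: "\<nu> (Y + B) \<le> d - \<nu> F" .
    then have "Y \<in> \<F>" using per \<open>Y \<noteq> {}\<close> F_pos by (simp add: \<F>_def)
    moreover have "f Y \<le> \<kappa>" using le \<nu>Y F(2) by (simp add: f_def)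
    ultimately have "f Y = \<kappa>" using \<kappa>_le by force
    then show ?thesis using F_min[OF \<open>Y \<in> \<F>\<close>] \<nu>Y by simp
  qed
  \<comment> \<open>Submodularity: the intersection is admissible but smaller than \<open>F\<close>,
    hence not extremal, which pushes \<open>f\<close> of the union below
    \<open>\<kappa>\<close>.\<close>
  have atoms: "F = F'" if F': "F' \<in> \<F>" "f F' = \<kappa>" "\<nu> F' = \<nu> F" and int: "F \<inter> F' \<noteq> {}" for F'
  proof (rule ccontr)
    assume neq: "F \<noteq> F'"
    have per': "periodic d F'" using F' by (simp add: \<F>_def)
    have lt: "\<nu> (F \<inter> F') < \<nu> F"
    proof (rule ccontr)
      assume "\<not> ?thesis"
      then have ge: "residue_count d F \<le> residue_count d (F \<inter> F')"
        "residue_count d F' \<le> residue_count d (F \<inter> F')"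
        using F'(3) by (simp_all add: \<nu>_def)
      note perI = periodic_Int[OF perF per']
      have "F \<inter> F' = F" by (rule periodic_subset_eq[OF d perI perF _ ge(1)]) simp
      moreover have "F \<inter> F' = F'" by (rule periodic_subset_eq[OF d perI per' _ ge(2)]) simp
      ultimately have "F \<inter> F' = F" "F \<inter> F' = F'" .
      then show False using neq by simp
    qed
    have IntF: "F \<inter> F' \<in> \<F>"
    proof -
      have "\<nu> (F \<inter> F' + B) \<le> \<nu> (F + B)" by (intro \<nu>_mono set_plus_mono2) auto
      then show ?thesis using int F(1) perF per' by (auto simp: \<F>_def periodic_Int)
    qed
    have "f (F \<inter> F') \<noteq> \<kappa>" using F_min[OF IntF] lt by auto
    then have fInt: "f (F \<inter> F') \<ge> \<kappa> + 1" using \<kappa>_le[OF IntF] by simp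
    have "\<nu> ((F \<union> F') + B) + \<nu> ((F \<inter> F') + B) \<le> \<nu> (F + B) + \<nu> (F' + B)"
    proof -
      have "(F \<union> F') + B = (F + B) \<union> (F' + B)" by (auto simp: set_plus_def)
      moreover have "\<nu> ((F \<inter> F') + B) \<le> \<nu> ((F + B) \<inter> (F' + B))"
        by (intro \<nu>_mono) (auto simp: set_plus_def)
      moreover have "\<nu> ((F + B) \<union> (F' + B)) + \<nu> ((F + B) \<inter> (F' + B)) = \<nu> (F + B) + \<nu> (F' + B)"
        using residue_count_Un_Int[OF d periodic_plus[OF perF, of B] periodic_plus[OF per', of B]]
        by (simp add: \<nu>_def)
      ultimately show ?thesis by simp
    qed
    moreover have modular: "\<nu> (F \<union> F') + \<nu> (F \<inter> F') = \<nu> F + \<nu> F'"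
      using residue_count_Un_Int[OF d perF per'] by (simp add: \<nu>_def)
    ultimately have fUn: "f (F \<union> F') \<le> \<kappa> - 1" using fInt F(2) F'(2) by (simp add: f_def)
    have perU: "periodic d (F \<union> F')" using perF per' by (rule periodic_Un)
    show False
    proof (cases "\<nu> ((F \<union> F') + B) < d")
      case True
      then have "F \<union> F' \<in> \<F>" using perU F0 by (auto simp: \<F>_def)
      then show False using \<kappa>_le fUn by force
    next
      \<comment> \<open>The union now has at least \<open>d - \<kappa> + 1\<close> classes. But
        \<open>co_atom\<close> gives \<open>2 * \<nu> F \<le> d - \<kappa>\<close>, and the
        intersection is nonempty.\<close>
      case False
      have "\<nu> (F \<inter> F') > 0" using int residue_count_pos[OF d] by (simp add: \<nu>_def)
      then show False using False fUn modular co_atom F(2) F'(3) by (simp add: f_def)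
    qed
  qed
  \<comment> \<open>The translate of \<open>F\<close> by \<open>- y\<close> contains 0, so it meets
    \<open>F\<close> and equals it.\<close>
  have "x - y \<in> F" if "x \<in> F" "y \<in> F" for x y
  proof -
    have "0 \<in> (\<lambda>x. x + (- y)) ` F" using that by (auto intro!: image_eqI[of _ _ y])
    then have "F \<inter> (\<lambda>x. x + (- y)) ` F \<noteq> {}" using F0 by blast
    then have "F = (\<lambda>x. x + (- y)) ` F"
      using F(2) translate[OF F(1), of "- y"] by (metis atoms)
    then show ?thesis using that by (metis add_uminus_conv_diff imageI)
  qed
  moreover have "d \<in> F" using perF F0 unfolding periodic_def by (metis mod_0 mod_self)
  ultimately obtain e where e: "e > 0" "e dvd d" "F = {x. e dvd x}"
    using subgroup_eq_multiples d by metis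
  have "periodic e F" unfolding e periodic_def by (metis dvd_eq_mod_eq_0 mem_Collect_eq)
  then have perFB: "periodic e (F + B)" by (rule periodic_plus)
  have "residue_count e F = 1"
  proof -
    have "(\<lambda>x. x mod e) ` F = {0}" using e F0 by (auto simp: image_iff)
    then show ?thesis by (simp add: residue_count_def)
  qed
  then have \<nu>F': "\<nu> F = d div e"
    using residue_count_coarser[OF e(1) d e(2) \<open>periodic e F\<close>] by (simp add: \<nu>_def)
  have "F + B = residue_hull e B"
  proof -
    have "F = residue_hull e {0}" unfolding e residue_hull_def by (auto simp: dvd_eq_mod_eq_0)
    then have "F + B = residue_hull e ({0} + B)" by (metis hull_plus)
    then show ?thesis by simp
  qed
  \<comment> \<open>\<open>d div e\<close> is the order of the subgroup generated by
    \<open>e\<close> modulo \<open>d\<close>; each of its cosets met by \<open>B\<close> is counted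
    with that weight.\<close>
  then have \<nu>FB: "\<nu> (F + B) = (d div e) * int (residue_count e B)"
    using residue_count_coarser[OF e(1) d e(2) perFB] residue_count_hull by (simp add: \<nu>_def)
  have "d = (d div e) * e" using e by simp
  then have "(d div e) * int (residue_count e B) < (d div e) * e" using \<nu>FB F(1) by (simp add: \<F>_def)
  then have "int (residue_count e B) < e" using \<nu>F' F_pos by (simp add: mult_less_cancel_left)
  moreover have "f F < \<nu> B - 1" using X' \<kappa>_le F(2) by force
  then have "(d div e) * int (residue_count e B) + 1 < d div e + int (residue_count d B)"
    using \<nu>F' \<nu>FB by (simp add: f_def \<nu>_def)
  ultimately show thesis using that e by blast
qed

section \<open>Sumsets and residue classes\<close>

lemma hfold_sumset_0: "hfold_sumset 0 X = {0}"
  by (auto simp: hfold_sumset_def)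

lemma hfold_sumset_Suc: "hfold_sumset (Suc h) X = hfold_sumset h X + X"
proof (intro equalityI subsetI)
  fix z assume "z \<in> hfold_sumset (Suc h) X"
  then obtain x xs where "length xs = h" "x \<in> X" "set xs \<subseteq> X" "z = sum_list xs + x"
    by (auto simp: hfold_sumset_def length_Suc_conv)
  then show "z \<in> hfold_sumset h X + X" by (auto simp: hfold_sumset_def intro!: set_plus_intro)
next
  fix z assume "z \<in> hfold_sumset h X + X"
  then obtain x xs where "length xs = h" "x \<in> X" "set xs \<subseteq> X" "z = sum_list xs + x"
    by (auto simp: hfold_sumset_def set_plus_def)
  then show "z \<in> hfold_sumset (Suc h) X"
    by (auto simp: hfold_sumset_def intro!: exI[of _ "x # xs"])
qed

lemma finite_hfold_sumset: "finite X \<Longrightarrow> finite (hfold_sumset h X)"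
  by (induction h) (auto simp: hfold_sumset_0 hfold_sumset_Suc finite_set_plus)

lemma zero_in_hfold_sumset: "0 \<in> X \<Longrightarrow> 0 \<in> hfold_sumset h X"
  by (auto simp: hfold_sumset_def sum_list_replicate intro!: exI[of _ "replicate h 0"])

text \<open>The translates of \<open>X\<close> by \<open>Min Y\<close> and of \<open>Y\<close> by
  \<open>Max X\<close> lie in the sumset and share at most one point.\<close>

lemma card_set_plus_ge:
  fixes X Y :: "int set"
  assumes "finite X" "finite Y" "X \<noteq> {}" "Y \<noteq> {}"
  shows "int (card (X + Y)) \<ge> int (card X) + int (card Y) - 1"
proof -
  let ?P = "(\<lambda>x. x + Min Y) ` X" and ?Q = "(\<lambda>y. Max X + y) ` Y"
  have "?P \<inter> ?Q \<subseteq> {Max X + Min Y}"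
  proof
    fix z assume "z \<in> ?P \<inter> ?Q"
    then obtain x y where "x \<in> X" "y \<in> Y" "z = x + Min Y" "z = Max X + y" by auto
    moreover from this have "x \<le> Max X" "Min Y \<le> y" using assms by auto
    ultimately show "z \<in> {Max X + Min Y}" by simp
  qed
  then have "card (?P \<inter> ?Q) \<le> 1" using card_mono[of "{Max X + Min Y}"] by fastforce
  moreover have "card ?P + card ?Q = card (?P \<union> ?Q) + card (?P \<inter> ?Q)"
    using assms by (intro card_Un_Int) auto
  moreover have "card ?P = card X" "card ?Q = card Y" by (auto intro!: card_image simp: inj_on_def)
  moreover have "?P \<union> ?Q \<subseteq> X + Y"
    using Min_in[OF assms(2,4)] Max_in[OF assms(1,3)] by (auto intro: set_plus_intro)
  then have "card (?P \<union> ?Q) \<le> card (X + Y)"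
    using assms by (intro card_mono finite_set_plus)
  ultimately show ?thesis by linarith
qed

text \<open>Each term of \<open>xs\<close> may vary within its class modulo \<open>d\<close> without
  changing the class of the sum; every such set of at least \<open>w\<close> choices gains
  \<open>w - 1\<close> elements.\<close>

lemma card_congruent_sums_ge:
  fixes w :: int
  assumes "finite A" "set xs \<subseteq> A"
    and "\<And>x. x \<in> set xs \<Longrightarrow> w \<le> int (card {y \<in> A. y mod d = x mod d})"
  shows "\<exists>T \<subseteq> hfold_sumset (length xs) A. finite T \<and> T \<noteq> {} \<and> (\<forall>t\<in>T. t mod d = sum_list xs mod d) \<and>
    int (length xs) * (w - 1) + 1 \<le> int (card T)"
  using assms(2,3)
proof (induction xs)
  case Nil
  show ?case by (intro exI[of _ "{0}"]) (auto simp: hfold_sumset_0)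
next
  case (Cons x xs)
  then obtain T where T: "T \<subseteq> hfold_sumset (length xs) A" "finite T" "T \<noteq> {}"
    "\<forall>t\<in>T. t mod d = sum_list xs mod d" "int (length xs) * (w - 1) + 1 \<le> int (card T)"
    by auto
  let ?X = "{y \<in> A. y mod d = x mod d}"
  have X: "finite ?X" "?X \<noteq> {}" using assms(1) Cons.prems by auto
  have "int (card T) + int (card ?X) - 1 \<le> int (card (T + ?X))"
    using card_set_plus_ge[OF T(2) X(1) T(3) X(2)] .
  moreover have "w \<le> int (card ?X)" using Cons.prems by simp
  ultimately have "int (length (x # xs)) * (w - 1) + 1 \<le> int (card (T + ?X))"
    using T(5) by (simp add: algebra_simps)
  moreover have "T + ?X \<subseteq> hfold_sumset (length (x # xs)) A"
    using T(1) by (auto simp: hfold_sumset_Suc intro!: set_plus_mono2[THEN subsetD, of T _ ?X])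
  moreover have "t mod d = sum_list (x # xs) mod d" if t: "t \<in> T + ?X" for t
  proof -
    obtain s y where "s \<in> T" "y mod d = x mod d" "t = s + y" using t by (auto simp: set_plus_def)
    then show ?thesis using T(4) by (metis add.commute mod_add_cong sum_list.Cons)
  qed
  moreover have "T + ?X \<noteq> {}" using T(3) X(2) by (auto simp: set_plus_def)
  ultimately show ?case using finite_set_plus[OF T(2) X(1)] by blast
qed

text \<open>In a residue class modulo \<open>l\<close>, the largest element of \<open>S\<close>
  cannot lie in \<open>S'\<close>, since its shift by \<open>l\<close> would be a larger element of
  \<open>S\<close>. The periodic \<open>Z\<close> restricts the count to chosen classes.\<close>

lemma residue_count_le_card_diff:
  assumes "finite S" "l > 0" "\<And>x. x \<in> S' \<Longrightarrow> x + l \<in> S" "periodic l Z"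
  shows "residue_count l (S \<inter> Z) \<le> card ((S - S') \<inter> Z)"
proof -
  have "(\<lambda>x. x mod l) ` (S \<inter> Z) \<subseteq> (\<lambda>x. x mod l) ` ((S - S') \<inter> Z)"
  proof
    fix \<rho> assume "\<rho> \<in> (\<lambda>x. x mod l) ` (S \<inter> Z)"
    then obtain x where x: "x \<in> S \<inter> Z" "\<rho> = x mod l" by auto
    define M where "M = {y \<in> S. y mod l = \<rho>}"
    have M: "finite M" "M \<noteq> {}" using assms(1) x by (auto simp: M_def)
    then have "Max M \<in> M" by simp
    then have m: "Max M \<in> S" "Max M mod l = \<rho>" by (auto simp: M_def)
    moreover have "Max M \<in> Z" using m x assms(4) unfolding periodic_def by (metis IntD2)
    moreover have "Max M \<notin> S'"
    proof
      assume "Max M \<in> S'"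
      then have "Max M + l \<in> M" using assms(3) m by (simp add: M_def)
      then have "Max M + l \<le> Max M" using M(1) by (rule Max_ge[rotated])
      then show False using assms(2) by simp
    qed
    ultimately show "\<rho> \<in> (\<lambda>x. x mod l) ` ((S - S') \<inter> Z)" by blast
  qed
  then have "residue_count l (S \<inter> Z) \<le> card ((\<lambda>x. x mod l) ` ((S - S') \<inter> Z))"
    unfolding residue_count_def using assms(1) by (intro card_mono) auto
  also have "\<dots> \<le> card ((S - S') \<inter> Z)" using assms(1) by (intro card_image_le) auto
  finally show ?thesis .
qed

section \<open>Residues modulo \<open>l\<close> within the classes modulo a divisor\<close>

lemma residue_count_split:
  assumes "l > 0" "d dvd l"
  shows "residue_count l A = (\<Sum>c\<in>(\<lambda>x. x mod d) ` A. residue_count l {x \<in> A. x mod d = c})"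
proof -
  have fin: "finite ((\<lambda>x. x mod d) ` A)"
  proof -
    have "(\<lambda>x. x mod d) ` A = (\<lambda>x. x mod d) ` (\<lambda>x. x mod l) ` A"
      using assms by (simp add: image_image mod_mod_cancel)
    then show ?thesis using finite_residues[OF assms(1)] by simp
  qed
  have "(\<lambda>x. x mod l) ` A = (\<Union>c\<in>(\<lambda>x. x mod d) ` A. (\<lambda>x. x mod l) ` {x \<in> A. x mod d = c})" by auto
  moreover have "card \<dots> = (\<Sum>c\<in>(\<lambda>x. x mod d) ` A. card ((\<lambda>x. x mod l) ` {x \<in> A. x mod d = c}))"
  proof (intro card_UN_disjoint fin ballI impI)
    fix c c' :: int assume "c \<noteq> c'"
    then show "(\<lambda>x. x mod l) ` {x \<in> A. x mod d = c} \<inter> (\<lambda>x. x mod l) ` {x \<in> A. x mod d = c'} = {}"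
      using assms(2) by auto (metis mod_mod_cancel)
  qed (rule finite_residues[OF assms(1)])
  ultimately show ?thesis by (simp add: residue_count_def)
qed

lemma residue_count_class_le:
  assumes "d > 0" "q > 0" "\<And>x. x \<in> P \<Longrightarrow> x mod d = c"
  shows "int (residue_count (d * q) P) \<le> q"
proof (cases "P = {}")
  case True
  then show ?thesis using assms by (simp add: residue_count_def)
next
  case False
  then have c: "0 \<le> c" "c < d" using assms by fastforce+
  have "d * q > 0" using assms by simp
  then have "(\<lambda>x. x mod (d * q)) ` P \<subseteq> {x \<in> {0..<d * q}. x mod d = c}"
    using assms(3) by (auto simp: mod_mod_cancel)
  then have "residue_count (d * q) P \<le> card {x \<in> {0..<d * q}. x mod d = c}"
    unfolding residue_count_def by (intro card_mono) (auto intro: finite_subset[of _ "{0..<d * q}"])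
  then show ?thesis using card_residue_class[of d q c] assms c by simp
qed

text \<open>\<open>P\<close> and the set of all \<open>y - z\<close> with \<open>z\<close> in
  \<open>Q\<close> lie in one class modulo \<open>d\<close>, which has only \<open>q\<close>
  residues modulo \<open>d * q\<close>; jointly larger than that, they share a residue.\<close>

lemma residue_class_pigeonhole:
  assumes "d > 0" "q > 0" and P: "\<And>x. x \<in> P \<Longrightarrow> x mod d = p mod d"
    and Q: "\<And>x. x \<in> Q \<Longrightarrow> x mod d = s mod d"
    and large: "q < int (residue_count (d * q) P) + int (residue_count (d * q) Q)"
    and y: "y mod d = (p + s) mod d"
  obtains x z where "x \<in> P" "z \<in> Q" "(x + z) mod (d * q) = y mod (d * q)"
proof -
  let ?l = "d * q"
  have l: "?l > 0" using assms by simp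
  define Q' where "Q' = (\<lambda>z. z + y) ` uminus ` Q"
  have Q': "residue_count ?l Q' = residue_count ?l Q"
    unfolding Q'_def by (simp add: residue_count_translate[OF l] residue_count_uminus[OF l])
  have Q'p: "x mod d = p mod d" if "x \<in> Q'" for x
  proof -
    from that obtain z where "z \<in> Q" "x = y - z" unfolding Q'_def by auto
    then have "x mod d = (p + s - s) mod d" using Q y by (metis mod_diff_cong)
    then show ?thesis by simp
  qed
  have "(\<lambda>x. x mod ?l) ` P \<inter> (\<lambda>x. x mod ?l) ` Q' \<noteq> {}"
  proof
    assume "(\<lambda>x. x mod ?l) ` P \<inter> (\<lambda>x. x mod ?l) ` Q' = {}"
    then have "residue_count ?l (P \<union> Q') = residue_count ?l P + residue_count ?l Q'"
      unfolding residue_count_def image_Un by (intro card_Un_disjoint finite_residues[OF l])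
    moreover have "int (residue_count ?l (P \<union> Q')) \<le> q"
      using P Q'p by (intro residue_count_class_le[OF assms(1,2)]) auto
    ultimately show False using large Q' by simp
  qed
  then obtain x z where "x \<in> P" "z \<in> Q" "x mod ?l = (y - z) mod ?l"
    unfolding Q'_def by auto
  then have "(x + z) mod ?l = (y - z + z) mod ?l" by (metis mod_add_cong)
  then show thesis using that \<open>x \<in> P\<close> \<open>z \<in> Q\<close> by simp
qed

section \<open>Growth of sumsets modulo \<open>d\<close>\<close>

text \<open>If adding \<open>A\<close> gives no new class, every element of \<open>A\<close>
  stabilises the hull of \<open>S\<close>. The stabiliser is a subgroup, and gcd 1 makes it all of
  the integers.\<close>

lemma generating_set_growth:
  assumes d: "d > 0" and "Gcd A = 1" "S \<noteq> {}" "S \<subseteq> S + A"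
    and le: "residue_count d (S + A) \<le> residue_count d S"
  shows "int (residue_count d S) = d"
proof -
  define E where "E = residue_hull d S"
  have per: "periodic d E" by (simp add: E_def periodic_hull)
  define K where "K = {t. (\<lambda>x. x + t) ` E = E}"
  have "E = residue_hull d (S + A)"
  proof (rule periodic_subset_eq[OF d])
    show "E \<subseteq> residue_hull d (S + A)" using assms(4) by (auto simp: E_def residue_hull_def)
  qed (auto simp: per periodic_hull residue_count_hull le E_def)
  then have EA: "E + A = E" by (metis E_def hull_plus)
  have "A \<subseteq> K"
  proof
    fix t assume "t \<in> A"
    have "(\<lambda>x. x + t) ` E \<subseteq> E + A" using \<open>t \<in> A\<close> by (auto intro: set_plus_intro)
    then have "(\<lambda>x. x + t) ` E \<subseteq> E" by (simp only: EA)
    then have "(\<lambda>x. x + t) ` E = E"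
      using periodic_subset_eq[OF d periodic_translate[OF per, of t] per] residue_count_translate[OF d]
      by simp
    then show "t \<in> K" by (simp add: K_def)
  qed
  have diff: "x - y \<in> K" if "x \<in> K" "y \<in> K" for x y
  proof -
    have "(\<lambda>z. z + (x - y)) ` (\<lambda>z. z + y) ` E = (\<lambda>z. z + x) ` E" by (simp add: image_image)
    then show ?thesis using that by (simp add: K_def)
  qed
  have "(\<lambda>x. x + d) ` E = E"
  proof (rule periodic_subset_eq[OF d periodic_translate[OF per] per])
    show "(\<lambda>x. x + d) ` E \<subseteq> E" using per unfolding periodic_def by (auto; metis mod_add_self2)
  qed (simp add: residue_count_translate[OF d])
  then have "d \<in> K" by (simp add: K_def)
  obtain e where e: "e > 0" "K = {x. e dvd x}" using subgroup_eq_multiples[OF diff \<open>d \<in> K\<close> d] by metis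
  then have "e dvd Gcd A" using \<open>A \<subseteq> K\<close> by (intro Gcd_greatest) auto
  then have K: "K = UNIV" using assms(2) e by (auto elim: dvd_trans)
  have "E = UNIV"
  proof -
    obtain x where "x \<in> E" using assms(3) subset_hull[of S d] by (auto simp: E_def)
    have "y \<in> E" for y
    proof -
      have "y - x \<in> K" using K by simp
      then have "(\<lambda>z. z + (y - x)) ` E = E" by (simp add: K_def)
      moreover have "y \<in> (\<lambda>z. z + (y - x)) ` E" using \<open>x \<in> E\<close> by (intro image_eqI[of _ _ x]) auto
      ultimately show ?thesis by simp
    qed
    then show ?thesis by auto
  qed
  then have "residue_count d S = residue_count d UNIV" by (metis E_def residue_count_hull)
  also have "\<dots> = card {0..<d}" using d by (subst residue_count_periodic) (auto simp: periodic_def)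
  finally show ?thesis using d by simp
qed

text \<open>\<open>l\<close> itself satisfies the first four conditions, so there is a least such
  \<open>d\<close>. If the Cauchy-Davenport bound modulo \<open>d\<close> failed for some
  \<open>X\<close>, Mann's theorem would yield a smaller divisor with the same properties.\<close>

lemma critical_modulus:
  fixes l :: int
  assumes l: "l > 0" and A: "A \<noteq> {}" "int (residue_count l A) < l"
  obtains d where "d > 0" "d dvd l" "int (residue_count d A) < d"
    "(l div d) * int (residue_count d A) + 1 \<le> int (residue_count l A) + l div d"
    "\<And>X. X \<noteq> {} \<Longrightarrow> min d (int (residue_count d X) + int (residue_count d A) - 1) \<le> int (residue_count d (X + A))"
proof -
  define P where "P = (\<lambda>d. d > 0 \<and> d dvd l \<and> int (residue_count d A) < d \<and>
    (l div d) * int (residue_count d A) + 1 \<le> int (residue_count l A) + l div d)"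
  have "P l" using l A by (simp add: P_def)
  then obtain d where d: "P d" and least: "\<And>e. P e \<Longrightarrow> nat d \<le> nat e"
    using ex_has_least_nat[of P l nat] by blast
  have d': "d > 0" "d dvd l" "int (residue_count d A) < d"
    "(l div d) * int (residue_count d A) + 1 \<le> int (residue_count l A) + l div d"
    using d by (auto simp: P_def)
  have "min d (int (residue_count d X) + int (residue_count d A) - 1) \<le> int (residue_count d (X + A))"
    if ne: "X \<noteq> {}" for X
  proof (rule ccontr)
    assume "\<not> ?thesis"
    then have "int (residue_count d (X + A)) < d"
      "residue_count d (X + A) + 1 < residue_count d X + residue_count d A" by auto
    then obtain e where e: "e > 0" "e dvd d" "int (residue_count e A) < e"
      "(d div e) * int (residue_count e A) + 1 < d div e + int (residue_count d A)"
      using Mann_cyclic[OF d'(1) ne A(1)] by metis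
    define q where "q = l div d"
    have l_eq: "l = d * q" using d' by (simp add: q_def)
    have q: "q > 0" using l l_eq d'(1) by (simp add: zero_less_mult_iff)
    have ldive: "l div e = q * (d div e)" using e by (simp add: l_eq div_mult_swap mult.commute)
    \<comment> \<open>The two estimates compose: Mann's inequality for \<open>e\<close>, scaled by
      \<open>q\<close>, is added to the one for \<open>d\<close>. Its strictness gives the 2 in
      place of 1.\<close>
    have "q * ((d div e) * int (residue_count e A) + 2) \<le> q * (d div e + int (residue_count d A))"
      using e(4) q by (intro mult_left_mono) auto
    then have "(l div e) * int (residue_count e A) + 1 \<le> int (residue_count l A) + l div e"
      using d'(4) q unfolding ldive q_def[symmetric] by (simp add: algebra_simps)
    then have "P e" using e d' by (auto simp: P_def elim: dvd_trans)
    then have "nat d \<le> nat e" by (rule least)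
    moreover have "e \<le> d" using e d' zdvd_imp_le by blast
    ultimately have "e = d" using e d' by simp
    then show False using e d' by simp
  qed
  then show thesis using that d' by blast
qed

lemma hfold_sumset_residue_growth:
  assumes d: "d > 0" and A: "A \<noteq> {}"
    and step: "\<And>X. X \<noteq> {} \<Longrightarrow>
      min d (int (residue_count d X) + int (residue_count d A) - 1) \<le> int (residue_count d (X + A))"
  shows "min d (int h * (int (residue_count d A) - 1) + 1) \<le> int (residue_count d (hfold_sumset h A))"
proof (induction h)
  case 0
  show ?case by (simp add: hfold_sumset_0 residue_count_def)
next
  case (Suc h)
  have u: "int (residue_count d A) \<ge> 1" using residue_count_pos[OF d A] by simp
  have "hfold_sumset h A \<noteq> {}"
  proof -
    obtain a where "a \<in> A" using A by auto
    then have "sum_list (replicate h a) \<in> hfold_sumset h A"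
      unfolding hfold_sumset_def by (intro CollectI exI[of _ "replicate h a"]) auto
    then show ?thesis by auto
  qed
  note step = step[OF this]
  have "int h * (int (residue_count d A) - 1) \<ge> 0" using u by simp
  moreover have "int (Suc h) * (int (residue_count d A) - 1)
      = int h * (int (residue_count d A) - 1) + (int (residue_count d A) - 1)" by (simp add: algebra_simps)
  ultimately show ?case using step Suc u unfolding hfold_sumset_Suc by linarith
qed

section \<open>Lev's inequality\<close>

lemma card_hfold_sumset_growth:
  fixes A :: "int set" and l :: int
  assumes A: "A \<subseteq> {0..l}" "0 \<in> A" "l \<in> A" and l: "l > 0" and gcd: "Gcd A = 1" and h: "h \<ge> 2"
  shows "int (card (hfold_sumset (h - 1) A)) + min l (int h * (int (card A) - 2) + 1)
    \<le> int (card (hfold_sumset h A))"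
proof -
  \<comment> \<open>As \<open>h \<ge> 2\<close>, two summands from \<open>A\<close> can be split
    off, \<open>S = S0 + A + A\<close>; the pigeonhole argument needs both.\<close>
  define S0 where "S0 = hfold_sumset (h - 2) A"
  define S' where "S' = hfold_sumset (h - 1) A"
  define S where "S = hfold_sumset h A"
  have finA: "finite A" using A(1) finite_subset by blast
  have "h - 1 = Suc (h - 2)" "h = Suc (h - 1)" using h by auto
  then have S': "S' = S0 + A" and S: "S = S' + A"
    unfolding S_def S'_def S0_def by (metis hfold_sumset_Suc)+
  have finS: "finite S" "finite S'" unfolding S_def S'_def by (intro finite_hfold_sumset finA)+
  have S'_sub: "S' \<subseteq> S"
  proof
    fix x assume "x \<in> S'"
    then have "x + 0 \<in> S' + A" using A(2) by (rule set_plus_intro)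
    then show "x \<in> S" by (simp add: S)
  qed
  have zero: "0 \<in> S'" "0 \<in> S0" by (simp_all add: S'_def S0_def zero_in_hfold_sumset A(2))
  have A_sub: "A \<subseteq> S" using zero set_plus_intro[of 0 S' _ A] by (auto simp: S)
  have shift: "x + l \<in> S" if "x \<in> S'" for x using that A(3) unfolding S by (rule set_plus_intro)
  have card_S: "int (card S) = int (card S') + int (card (S - S'))"
    using finS S'_sub by (simp add: card_Diff_subset card_mono)
  define N where "N = int (residue_count l A)"
  \<comment> \<open>Only the endpoints 0 and \<open>l\<close> coincide modulo \<open>l\<close>, so
    one residue is lost.\<close>
  have N: "int (card A) - 1 \<le> N"
  proof -
    have "card ((\<lambda>x. x mod l) ` (A - {l})) = card (A - {l})"
    proof (rule card_image, rule inj_onI)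
      fix x y assume "x \<in> A - {l}" "y \<in> A - {l}" "x mod l = y mod l"
      moreover have "z mod l = z" if "z \<in> A - {l}" for z
        using that A(1) by (intro mod_pos_pos_trivial) (auto simp: order_less_le)
      ultimately show "x = y" by simp
    qed
    moreover have "residue_count l (A - {l}) \<le> residue_count l A" by (intro residue_count_mono l) auto
    ultimately show ?thesis using A(3) finA by (simp add: N_def residue_count_def card_Diff_singleton)
  qed
  have goal: "min l (int h * (N - 1) + 1) \<le> int (card (S - S'))"
  proof (cases "N = l")
    case True
    have "residue_count l A \<le> residue_count l S" by (intro residue_count_mono l A_sub)
    also have "\<dots> \<le> card (S - S')"
      using residue_count_le_card_diff[of S l S' UNIV, OF finS(1) l shift] by (simp add: periodic_def)
    finally show ?thesis using True by (simp add: N_def)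
  next
    case False
    then have "int (residue_count l A) < l" using residue_count_le[OF l, of A] by (simp add: N_def)
    moreover have Ane: "A \<noteq> {}" using A(2) by auto
    ultimately obtain d where d: "d > 0" "d dvd l" and ud: "int (residue_count d A) < d"
      and crit: "(l div d) * int (residue_count d A) + 1 \<le> int (residue_count l A) + l div d"
      and step: "\<And>X. X \<noteq> {} \<Longrightarrow>
        min d (int (residue_count d X) + int (residue_count d A) - 1) \<le> int (residue_count d (X + A))"
      using critical_modulus[OF l] by blast
    define u where "u = int (residue_count d A)"
    define q where "q = l div d"
    have l_eq: "l = d * q" using d by (simp add: q_def)
    have q: "q > 0" using l l_eq d(1) by (simp add: zero_less_mult_iff)
    define n where "n = (\<lambda>c. int (residue_count l {x \<in> A. x mod d = c}))"
    \<comment> \<open>Counts the holes: residues modulo \<open>l\<close> that \<open>A\<close> lacks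
      in the classes modulo \<open>d\<close> it meets.\<close>
    define \<epsilon> where "\<epsilon> = q * u - N"
    have \<epsilon>: "\<epsilon> \<le> q - 1" using crit by (simp add: \<epsilon>_def q_def u_def N_def)
    define R where "R = (\<lambda>x. x mod d) ` A"
    have R: "finite R" "int (card R) = u" using finA by (auto simp: R_def u_def residue_count_def)
    have n_le: "n c \<le> q" for c
      unfolding n_def l_eq by (rule residue_count_class_le[OF d(1) q]) auto
    have holes: "(\<Sum>c\<in>R. q - n c) = \<epsilon>"
    proof -
      have "N = (\<Sum>c\<in>R. n c)"
        unfolding N_def n_def R_def by (subst residue_count_split[OF l d(2)]) simp
      then show ?thesis using R by (simp add: sum_subtractf \<epsilon>_def mult.commute)
    qed
    have hole1: "q - n (a mod d) \<le> \<epsilon>" if "a \<in> A" for a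
      using that R(1) n_le member_le_sum[of "a mod d" R "\<lambda>c. q - n c"] holes by (auto simp: R_def)
    \<comment> \<open>As \<open>\<epsilon> < q\<close>, two different classes of \<open>A\<close>
      together have more than \<open>q\<close> residues, which is what the pigeonhole principle asks
      for.\<close>
    have hole2: "(q - n (a mod d)) + (q - n (b mod d)) \<le> \<epsilon>"
      if "a \<in> A" "b \<in> A" "a mod d \<noteq> b mod d" for a b
    proof -
      have "(\<Sum>c\<in>{a mod d, b mod d}. q - n c) \<le> (\<Sum>c\<in>R. q - n c)"
        using that R(1) n_le by (intro sum_mono2) (auto simp: R_def)
      then show ?thesis using that(3) holes by simp
    qed
    define C where "C = (\<lambda>x. x mod d) ` S"
    define C' where "C' = (\<lambda>x. x mod d) ` S'"
    have C: "finite C" "int (card C) = int (residue_count d S)"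
      and C': "finite C'" "int (card C') = int (residue_count d S')" "C' \<subseteq> C"
      using finS S'_sub by (auto simp: C_def C'_def residue_count_def)
    define g where "g = (\<lambda>c. int (card ((S - S') \<inter> {x. x mod d = c})))"
    have total: "(\<Sum>c\<in>C. g c) = int (card (S - S'))"
    proof -
      have "S - S' = (\<Union>c\<in>C. (S - S') \<inter> {x. x mod d = c})" by (auto simp: C_def)
      moreover have "card \<dots> = (\<Sum>c\<in>C. card ((S - S') \<inter> {x. x mod d = c}))"
        using finS C(1) by (intro card_UN_disjoint) auto
      ultimately show ?thesis by (simp add: g_def)
    qed
    have g_ge: "int (residue_count l (S \<inter> {x. x mod d = c})) \<le> g c" for c
    proof -
      have "periodic l {x. x mod d = c}"
        using d(2) unfolding periodic_def by (metis mem_Collect_eq mod_mod_cancel)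
      then show ?thesis
        using residue_count_le_card_diff[of S l S', OF finS(1) l shift] by (simp add: g_def)
    qed
    \<comment> \<open>If the last two summands come from classes with more than \<open>q\<close>
      residues together, their sums already fill the class \<open>c\<close> modulo \<open>l\<close>,
      and each residue in it contributes a new element.\<close>
    have full: "q \<le> g c" if s: "s \<in> S0" "a \<in> A" "b \<in> A" "(s + a + b) mod d = c"
      and large: "q < n (a mod d) + n (b mod d)" for s a b c
    proof -
      have "{y \<in> {0..<d * q}. y mod d = c} \<subseteq> (\<lambda>x. x mod l) ` (S \<inter> {x. x mod d = c})"
      proof
        fix y assume y: "y \<in> {y \<in> {0..<d * q}. y mod d = c}"
        then have "y mod d = (s + a + b) mod d" using s by simp
        then have "(y - s) mod d = (s + a + b - s) mod d" by (rule mod_diff_cong) simp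
        then have ys: "(y - s) mod d = (a + b) mod d" by simp
        obtain x z where x: "x \<in> {x \<in> A. x mod d = a mod d}" "z \<in> {x \<in> A. x mod d = b mod d}"
          "(x + z) mod (d * q) = (y - s) mod (d * q)"
          by (rule residue_class_pigeonhole[OF d(1) q _ _ _ ys,
                of "{x \<in> A. x mod d = a mod d}" "{x \<in> A. x mod d = b mod d}"])
            (use large in \<open>auto simp: n_def l_eq\<close>)
        have "s + x + z \<in> S" unfolding S S' using x s by (intro set_plus_intro) auto
        moreover have "(s + (x + z)) mod (d * q) = (s + (y - s)) mod (d * q)"
          by (rule mod_add_cong[OF refl x(3)])
        then have eq: "(s + x + z) mod l = y" using y l_eq by (simp add: add.assoc)
        moreover have "(s + x + z) mod d = c"
          using y d(2) eq by (metis (mono_tags) mem_Collect_eq mod_mod_cancel)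
        ultimately show "y \<in> (\<lambda>x. x mod l) ` (S \<inter> {x. x mod d = c})" by blast
      qed
      then have "card {y \<in> {0..<d * q}. y mod d = c} \<le> residue_count l (S \<inter> {x. x mod d = c})"
        unfolding residue_count_def by (intro card_mono finite_residues[OF l])
      moreover have "int (card {y \<in> {0..<d * q}. y mod d = c}) = q"
        using s(4) d(1) q by (intro card_residue_class) auto
      ultimately show ?thesis using g_ge[of c] by linarith
    qed
    \<comment> \<open>In a deficient class the last two terms of any sum come from one and the same
      class of \<open>A\<close>, which is at most half full.\<close>
    have sparse: "2 * n (b mod d) \<le> q" if "g c < q" "s \<in> S'" "b \<in> A" "(s + b) mod d = c" for s b c
    proof -
      from that(2) obtain s0 a where a: "s0 \<in> S0" "a \<in> A" "s = s0 + a"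
        unfolding S' by (elim set_plus_elim)
      then have le: "n (a mod d) + n (b mod d) \<le> q"
        using full[of s0 a b c] that by force
      then have "a mod d = b mod d" using hole2[OF a(2) that(3)] \<epsilon> by force
      then show ?thesis using le by simp
    qed
    have sparse_unique: "a mod d = b mod d"
      if "a \<in> A" "b \<in> A" "2 * n (a mod d) \<le> q" "2 * n (b mod d) \<le> q" for a b
      using hole2[OF that(1,2)] that(3,4) \<epsilon> by force
    have rep: "\<exists>s\<in>S'. sum_list xs = s + b"
      if "length xs = h" "set xs \<subseteq> A" "b \<in> set xs" for xs b
    proof
      show "sum_list (remove1 b xs) \<in> S'"
        using that set_remove1_subset[of b xs] unfolding S'_def hfold_sumset_def
        by (intro CollectI exI[of _ "remove1 b xs"]) (auto simp: length_remove1)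
      show "sum_list xs = sum_list (remove1 b xs) + b"
        using sum_list_map_remove1[OF that(3), of "\<lambda>x. x"] by simp
    qed
    \<comment> \<open>In a class not yet reached by \<open>h - 1\<close> summands, every element of \<open>S\<close> is new.\<close>
    have new_class: "int h * (w - 1) + 1 \<le> g c"
      if c: "c \<in> C - C'" and w: "\<And>a. a \<in> A \<Longrightarrow> a mod d \<noteq> 0 \<Longrightarrow> w \<le> n (a mod d)" for c w
    proof -
      obtain xs where xs: "length xs = h" "set xs \<subseteq> A" "c = sum_list xs mod d"
        using c by (auto simp: C_def S_def hfold_sumset_def)
      have w': "w \<le> int (card {y \<in> A. y mod d = x mod d})" if x: "x \<in> set xs" for x
      proof -
        \<comment> \<open>A term divisible by \<open>d\<close> could be dropped, and
          \<open>h - 1\<close> summands would already reach the class.\<close>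
        have "x mod d \<noteq> 0"
        proof
          assume "x mod d = 0"
          obtain s where "s \<in> S'" "sum_list xs = s + x" using rep[OF xs(1,2) x] by auto
          with \<open>x mod d = 0\<close> have "s mod d = c" using xs(3) by (metis add.right_neutral mod_add_right_eq)
          then show False using c \<open>s \<in> S'\<close> by (auto simp: C'_def)
        qed
        then have "w \<le> n (x mod d)" using x xs(2) by (intro w) auto
        also have "\<dots> \<le> int (card {y \<in> A. y mod d = x mod d})"
          unfolding n_def residue_count_def using finA by (simp add: card_image_le)
        finally show ?thesis .
      qed
      obtain T where T: "T \<subseteq> S" "\<forall>t\<in>T. t mod d = c" "int h * (w - 1) + 1 \<le> int (card T)"
        using card_congruent_sums_ge[OF finA xs(2) w'] xs(1,3) by (auto simp: S_def)
      have "T \<subseteq> (S - S') \<inter> {x. x mod d = c}"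
        using T(1,2) c by (auto simp: C'_def)
      then have "card T \<le> card ((S - S') \<inter> {x. x mod d = c})" using finS by (intro card_mono) auto
      then show ?thesis using T(3) by (simp add: g_def)
    qed
    \<comment> \<open>Otherwise \<open>A\<close> lies in the class of 0, and gcd 1 forces
      \<open>d = 1\<close>, where no class is missed.\<close>
    have u2: "u \<ge> 2"
    proof (rule ccontr)
      assume "\<not> u \<ge> 2"
      then have "card R \<le> 1" using R by simp
      moreover have "0 \<in> R" using A(2) by (auto simp: R_def image_iff intro: bexI[of _ 0])
      ultimately have "x = 0" if "x \<in> R" for x using card_le_Suc0_iff_eq[OF R(1)] that by simp
      then have "d dvd a" if "a \<in> A" for a using that by (auto simp: R_def dvd_eq_mod_eq_0)
      then have "d dvd Gcd A" by (intro Gcd_greatest)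
      then have "d = 1" using gcd d(1) by simp
      then show False using ud residue_count_pos[OF d(1) Ane] by simp
    qed
    have growth: "min d (int i * (u - 1) + 1) \<le> int (residue_count d (hfold_sumset i A))" for i
      unfolding u_def by (rule hfold_sumset_residue_growth[OF d(1) Ane step])
    have exists_new: "\<exists>c. c \<in> C - C'" if "int (residue_count d S') < d"
    proof (rule ccontr)
      assume "\<not> ?thesis"
      then have "C = C'" using C'(3) by auto
      then have "residue_count d (S' + A) = residue_count d S'"
        by (simp add: residue_count_def C_def C'_def S)
      then have "int (residue_count d S') = d"
        using zero S'_sub by (intro generating_set_growth[OF d(1) gcd]) (auto simp: S)
      then show False using that by simp
    qed
    \<comment> \<open>Every class of \<open>A\<close> has at least \<open>q - \<epsilon>\<close>
      residues, so the new class contributes \<open>h * (q - \<epsilon> - 1) + 1\<close>. At least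
      \<open>h * (u - 1)\<close> other classes contribute \<open>q\<close> each, and the sum is
      exactly \<open>h * (N - 1) + 1\<close>.\<close>
    have combine: ?thesis
      if c: "c \<in> C - C'" and others: "\<And>c'. c' \<in> C \<Longrightarrow> c' \<noteq> c \<Longrightarrow> q \<le> g c'"
        and large: "int h * (u - 1) + 1 \<le> int (card C)" for c
    proof -
      have "int h * ((q - \<epsilon>) - 1) + 1 \<le> g c" using hole1 by (intro new_class[OF c]) force
      moreover have "(int h * (u - 1)) * q \<le> (\<Sum>c'\<in>C - {c}. g c')"
      proof -
        have "(int h * (u - 1)) * q \<le> int (card (C - {c})) * q"
          using large c C(1) q by (intro mult_right_mono) (auto simp: card_Diff_singleton)
        also have "\<dots> \<le> (\<Sum>c'\<in>C - {c}. g c')"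
          using others by (intro sum_bounded_below) auto
        finally show ?thesis .
      qed
      moreover have "(\<Sum>c'\<in>C. g c') = g c + (\<Sum>c'\<in>C - {c}. g c')"
        using c C(1) by (intro sum.remove) auto
      ultimately have "int h * (u - 1) * q + (int h * ((q - \<epsilon>) - 1) + 1) \<le> int (card (S - S'))"
        using total by simp
      moreover have "int h * (u - 1) * q + (int h * ((q - \<epsilon>) - 1) + 1) = int h * (N - 1) + 1"
        unfolding \<epsilon>_def by (simp add: algebra_simps)
      ultimately show ?thesis by simp
    qed
    show ?thesis
    proof (cases "\<forall>c\<in>C. q \<le> g c")
      case True
      show ?thesis
      proof (cases "int (residue_count d S) = d")
        case full_S: True
        have "int (card C) * q \<le> (\<Sum>c\<in>C. g c)" using True by (intro sum_bounded_below) auto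
        then show ?thesis using total C(2) full_S l_eq by simp
      next
        case False
        then have lt: "int (residue_count d S) < d" using residue_count_le[OF d(1), of S] by simp
        then have "int (residue_count d S') < d" using residue_count_mono[OF d(1) S'_sub] by simp
        then obtain c where "c \<in> C - C'" using exists_new by auto
        moreover have "int h * (u - 1) + 1 \<le> int (card C)" using growth[of h] lt C(2) by (simp add: S_def)
        ultimately show ?thesis using True by (intro combine) auto
      qed
    next
      case False
      then obtain c0 where c0: "c0 \<in> C" "g c0 < q" by force
      then obtain s1 a1 where a1: "s1 \<in> S'" "a1 \<in> A" "(s1 + a1) mod d = c0"
        by (auto simp: C_def S elim!: set_plus_elim)
      have sparse_a1: "2 * n (a1 mod d) \<le> q" using sparse[OF c0(2) a1] .
      \<comment> \<open>All terms of a sum in a deficient class are congruent to \<open>a1\<close>,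
        since only one class of \<open>A\<close> can be at most half full. So \<open>h * a1\<close>
        determines the deficient class, and there is just one.\<close>
      have terms: "b mod d = a1 mod d" if "g c < q" "s \<in> S'" "b \<in> A" "(s + b) mod d = c" for s b c
        using sparse_unique[OF that(3) a1(2) sparse[OF that] sparse_a1] .
      have class_eq: "c = (int h * a1) mod d" if c: "c \<in> C" "g c < q" for c
      proof -
        obtain xs where xs: "length xs = h" "set xs \<subseteq> A" "c = sum_list xs mod d"
          using c(1) by (auto simp: C_def S_def hfold_sumset_def)
        have "b mod d = a1 mod d" if "b \<in> set xs" for b
          using rep[OF xs(1,2) that] terms[OF c(2)] xs that by (metis subsetD)
        then have "sum_list xs mod d = (int (length xs) * a1) mod d"
        proof (induction xs)
          case (Cons x xs)
          then have "(x + sum_list xs) mod d = (a1 + int (length xs) * a1) mod d"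
            by (intro mod_add_cong) auto
          then show ?case by (simp add: algebra_simps)
        qed simp
        then show ?thesis using xs by simp
      qed
      have others: "q \<le> g c" if "c \<in> C" "c \<noteq> c0" for c
        using class_eq[OF that(1)] class_eq[OF c0] that(2) by force
      \<comment> \<open>All representations of the deficient class end in \<open>a1\<close>, so \<open>C'\<close> misses \<open>u - 1\<close> classes.\<close>
      have C'_le: "int (card C') + (u - 1) \<le> d"
      proof -
        define D where "D = (\<lambda>c. (c0 - c) mod d) ` (R - {a1 mod d})"
        have "inj_on (\<lambda>c. (c0 - c) mod d) (R - {a1 mod d})"
        proof (rule inj_onI)
          fix x y assume xy: "x \<in> R - {a1 mod d}" "y \<in> R - {a1 mod d}" "(c0 - x) mod d = (c0 - y) mod d"
          have "(c0 - (c0 - x)) mod d = (c0 - (c0 - y)) mod d" by (rule mod_diff_cong[OF refl xy(3)])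
          then show "x = y" using xy(1,2) by (auto simp: R_def)
        qed
        then have "int (card D) = u - 1"
          using R a1(2) u2 by (simp add: D_def card_image card_Diff_singleton R_def)
        moreover have "C' \<inter> D = {}"
        proof (rule ccontr)
          assume "C' \<inter> D \<noteq> {}"
          then obtain s b where sb: "s \<in> S'" "b \<in> A" "b mod d \<noteq> a1 mod d"
            "s mod d = (c0 - b mod d) mod d" by (auto simp: C'_def D_def R_def)
          have "(s + b) mod d = (c0 - b + b) mod d" using sb(4) by (intro mod_add_cong) (auto simp: mod_diff_right_eq)
          then have "(s + b) mod d = c0" using a1(3) by auto
          then show False using terms[OF c0(2) sb(1,2)] sb(3) by simp
        qed
        moreover have "card (C' \<union> D) \<le> card {0..<d}"
          using d(1) by (intro card_mono) (auto simp: C'_def D_def)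
        moreover have "finite D" using R(1) by (simp add: D_def)
        ultimately show ?thesis using C'(1) d(1) by (simp add: card_Un_disjoint)
      qed
      have lt': "int (residue_count d S') < d" using C'_le C'(2) u2 by simp
      have "int (h - 1) * (u - 1) + 1 \<le> int (card C')"
        using growth[of "h - 1"] lt' C'(2) by (simp add: S'_def)
      moreover have "int h * (u - 1) = int (h - 1) * (u - 1) + (u - 1)"
        using h by (simp add: of_nat_diff algebra_simps)
      ultimately have "int h * (u - 1) + 1 \<le> d" using C'_le by simp
      \<comment> \<open>The cap \<open>d\<close> in \<open>growth\<close> is not the smaller
        argument here.\<close>
      then have large: "int h * (u - 1) + 1 \<le> int (card C)" using growth[of h] C(2) by (simp add: S_def)
      show ?thesis
      proof (cases "a1 mod d = 0")
        case False
        \<comment> \<open>Padding a sum of \<open>h - 1\<close> summands with 0 would give a term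
          not congruent to \<open>a1\<close>; so the deficient class is itself new.\<close>
        have "c0 \<notin> C'"
        proof
          assume "c0 \<in> C'"
          then obtain s where "s \<in> S'" "(s + 0) mod d = c0" by (auto simp: C'_def)
          then have "0 mod d = a1 mod d" using terms[OF c0(2)] A(2) by blast
          then show False using False by simp
        qed
        then show ?thesis using c0(1) others large by (intro combine[of c0]) auto
      next
        case True
        then have "c0 = 0" using class_eq[OF c0] by (metis mod_0 mod_mult_right_eq mult_zero_right)
        \<comment> \<open>The deficient class is that of 0, so a new class \<open>c\<close> has to
          make up for it. The terms reaching \<open>c\<close> avoid the class of 0, and by
          \<open>hole2\<close> their classes have at least \<open>2 * q - n 0 - \<epsilon>\<close>
          residues.\<close>
        obtain c where c: "c \<in> C - C'" using exists_new lt' by auto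
        have "0 \<in> C'" using zero(1) by (auto simp: C'_def intro!: image_eqI[of _ _ 0])
        then have "c \<noteq> 0" using c by auto
        have "n 0 \<le> int (residue_count l (S \<inter> {x. x mod d = 0}))"
          using A_sub by (auto simp: n_def intro!: residue_count_mono l)
        then have g0: "n 0 \<le> g 0" using g_ge[of 0] by simp
        have "int h * ((2 * q - n 0 - \<epsilon>) - 1) + 1 \<le> g c"
        proof (rule new_class[OF c])
          fix a assume "a \<in> A" "a mod d \<noteq> 0"
          then show "2 * q - n 0 - \<epsilon> \<le> n (a mod d)" using hole2[of a 0] A(2) by simp
        qed
        moreover have "(int h * (u - 1) - 1) * q \<le> (\<Sum>c'\<in>C - {0} - {c}. g c')"
        proof -
          have "card (C - {0} - {c}) = card C - 2"
            using c c0(1) \<open>c0 = 0\<close> \<open>c \<noteq> 0\<close> C(1) by (simp add: card_Diff_singleton)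
          then have "(int h * (u - 1) - 1) * q \<le> int (card (C - {0} - {c})) * q"
            using large q by (intro mult_right_mono) auto
          also have "\<dots> \<le> (\<Sum>c'\<in>C - {0} - {c}. g c')"
            using others \<open>c0 = 0\<close> by (intro sum_bounded_below) auto
          finally show ?thesis .
        qed
        moreover have "(\<Sum>c'\<in>C. g c') = g 0 + (g c + (\<Sum>c'\<in>C - {0} - {c}. g c'))"
          using c c0(1) \<open>c0 = 0\<close> \<open>c \<noteq> 0\<close> C(1) by (subst sum.remove[of C 0], simp_all, subst sum.remove[of "C - {0}" c], simp_all)
        ultimately have "n 0 + (int h * ((2 * q - n 0 - \<epsilon>) - 1) + 1) + (int h * (u - 1) - 1) * q
            \<le> int (card (S - S'))" using total g0 by simp
        \<comment> \<open>The emptier the class of 0, the fuller the other classes of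
          \<open>A\<close>: this leaves the surplus \<open>(h - 1) * (q - n 0)\<close>.\<close>
        moreover have "n 0 + (int h * ((2 * q - n 0 - \<epsilon>) - 1) + 1) + (int h * (u - 1) - 1) * q
            = int h * (N - 1) + 1 + (int h - 1) * (q - n 0)"
          unfolding \<epsilon>_def by (simp add: algebra_simps)
        moreover have "(int h - 1) * (q - n 0) \<ge> 0" using h n_le by simp
        ultimately show ?thesis by simp
      qed
    qed
  qed
  have "int h * (int (card A) - 2) \<le> int h * (N - 1)" using N by (intro mult_left_mono) auto
  then show ?thesis using goal card_S unfolding S_def S'_def by linarith
qed

section \<open>Subsequence sums\<close>

text \<open>The first entry is kept only if the rest cannot supply enough copies of its
  value.\<close>

lemma subseq_with_counts:
  assumes "\<And>x. g x \<le> count_list xs x"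
  shows "\<exists>ys. subseq ys xs \<and> (\<forall>x. count_list ys x = g x)"
  using assms
proof (induction xs arbitrary: g)
  case Nil
  then show ?case by (intro exI[of _ "[]"]) auto
next
  case (Cons x xs)
  show ?case
  proof (cases "g x \<le> count_list xs x")
    case True
    then have "g y \<le> count_list xs y" for y using Cons.prems[of y] by (cases "y = x") auto
    then obtain ys where "subseq ys xs" "\<forall>y. count_list ys y = g y" using Cons.IH by blast
    then show ?thesis by (intro exI[of _ ys]) auto
  next
    case False
    then have gx: "g x = Suc (count_list xs x)" using Cons.prems[of x] by simp
    have "(g(x := g x - 1)) y \<le> count_list xs y" for y using Cons.prems[of y] gx by (cases "y = x") auto
    then obtain ys where "subseq ys xs" "\<forall>y. count_list ys y = (g(x := g x - 1)) y" using Cons.IH by blast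
    then show ?thesis using gx by (intro exI[of _ "x # ys"]) auto
  qed
qed

lemma sum_list_eq_sum_count:
  fixes ys :: "int list"
  assumes "finite X" "set ys \<subseteq> X"
  shows "sum_list ys = (\<Sum>x\<in>X. int (count_list ys x) * x)"
  using assms(2)
proof (induction ys)
  case (Cons y ys)
  have "(\<Sum>x\<in>X. int (count_list (y # ys) x) * x)
      = (\<Sum>x\<in>X. int (count_list ys x) * x + (if x = y then y else 0))"
    by (intro sum.cong) (auto simp: algebra_simps)
  also have "\<dots> = (\<Sum>x\<in>X. int (count_list ys x) * x) + y"
    using Cons.prems assms(1) by (simp add: sum.distrib)
  finally show ?case using Cons by simp
qed simp

text \<open>Subsums are recorded by multiplicity vectors \<open>g\<close> instead of subsequences,
  which frees the counting from lists.\<close>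

definition bounded_sums :: "nat \<Rightarrow> (nat \<Rightarrow> int) \<Rightarrow> (nat \<Rightarrow> nat) \<Rightarrow> nat \<Rightarrow> int set" where
  "bounded_sums k a rs \<beta> = {\<Sum>i=1..k. int (g i) * a i | g. (\<forall>i\<in>{1..k}. g i \<le> rs i) \<and> (\<Sum>i=1..k. g i) \<le> \<beta>}"

lemma finite_bounded_sums:
  assumes "\<forall>i\<in>{1..k}. a i > 0"
  shows "finite (bounded_sums k a rs \<beta>)"
proof (rule finite_subset)
  show "bounded_sums k a rs \<beta> \<subseteq> {0..\<Sum>i=1..k. int (rs i) * a i}"
  proof
    fix x assume "x \<in> bounded_sums k a rs \<beta>"
    then obtain g where g: "\<forall>i\<in>{1..k}. g i \<le> rs i" "x = (\<Sum>i=1..k. int (g i) * a i)"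
      by (auto simp: bounded_sums_def)
    have "0 \<le> x" unfolding g using assms by (intro sum_nonneg) (auto simp: less_imp_le)
    moreover have "x \<le> (\<Sum>i=1..k. int (rs i) * a i)"
      unfolding g using assms g(1) by (intro sum_mono mult_right_mono) (auto simp: less_imp_le)
    ultimately show "x \<in> {0..\<Sum>i=1..k. int (rs i) * a i}" by simp
  qed
qed simp

text \<open>Removing a subsum of at most \<open>\<Sum> rs i - \<alpha>\<close> terms from the whole
  sequence leaves at least \<open>\<alpha>\<close> terms, and distinct subsums leave distinct
  rests.\<close>

lemma card_bounded_sums_le:
  assumes seq: "seq_with_mult k a rs AA" and \<alpha>: "\<alpha> \<le> (\<Sum>i=1..k. rs i)"
  shows "card (bounded_sums k a rs ((\<Sum>i=1..k. rs i) - \<alpha>)) \<le> card (subseq_sums \<alpha> AA)"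
proof -
  have inj: "inj_on a {1..k}" and setAA: "set AA = a ` {1..k}"
    and cnt: "\<And>i. i \<in> {1..k} \<Longrightarrow> count_list AA (a i) = rs i"
    using seq by (auto simp: seq_with_mult_def)
  define T where "T = (\<Sum>i=1..k. int (rs i) * a i)"
  have fin: "finite (subseq_sums \<alpha> AA)"
  proof -
    have "subseq_sums \<alpha> AA \<subseteq> sum_list ` set (subseqs AA)" by (auto simp: subseq_sums_def)
    then show ?thesis by (rule finite_subset) simp
  qed
  have "(\<lambda>x. T - x) ` bounded_sums k a rs ((\<Sum>i=1..k. rs i) - \<alpha>) \<subseteq> subseq_sums \<alpha> AA"
  proof
    fix z assume "z \<in> (\<lambda>x. T - x) ` bounded_sums k a rs ((\<Sum>i=1..k. rs i) - \<alpha>)"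
    then obtain g where g: "\<And>i. i \<in> {1..k} \<Longrightarrow> g i \<le> rs i"
      "(\<Sum>i=1..k. g i) \<le> (\<Sum>i=1..k. rs i) - \<alpha>" "z = T - (\<Sum>i=1..k. int (g i) * a i)"
      unfolding bounded_sums_def by blast
    \<comment> \<open>The complementary multiplicities, carried from indices to values; the default
      0 keeps foreign terms out of \<open>ys\<close>.\<close>
    define f where "f = (\<lambda>x. if x \<in> a ` {1..k} then rs (inv_into {1..k} a x) - g (inv_into {1..k} a x) else 0)"
    have f: "f (a i) = rs i - g i" if "i \<in> {1..k}" for i
      using that inj by (simp add: f_def inv_into_f_f)
    have "f x \<le> count_list AA x" for x
    proof (cases "x \<in> a ` {1..k}")
      case True
      then show ?thesis using f cnt by force
    qed (auto simp: f_def)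
    then obtain ys where ys: "subseq ys AA" "\<And>x. count_list ys x = f x"
      using subseq_with_counts[of f AA] by blast
    have sub: "set ys \<subseteq> a ` {1..k}"
      using ys(2) by (metis count_list_0_iff f_def subsetI)
    have "sum_list ys = (\<Sum>x\<in>a ` {1..k}. int (count_list ys x) * x)"
      using sub by (intro sum_list_eq_sum_count) auto
    also have "\<dots> = (\<Sum>i=1..k. int (rs i - g i) * a i)"
      using inj ys(2) f by (simp add: sum.reindex)
    also have "\<dots> = (\<Sum>i=1..k. int (rs i) * a i - int (g i) * a i)"
      using g(1) by (intro sum.cong) (auto simp: of_nat_diff algebra_simps)
    finally have "sum_list ys = z" by (simp add: g(3) T_def sum_subtractf)
    moreover have "length ys \<ge> \<alpha>"
    proof -
      have "length ys = (\<Sum>x\<in>a ` {1..k}. count_list ys x)" using sub by (simp add: sum_count_set)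
      also have "\<dots> = (\<Sum>i=1..k. rs i - g i)" using inj ys(2) f by (simp add: sum.reindex)
      also have "\<dots> = (\<Sum>i=1..k. rs i) - (\<Sum>i=1..k. g i)" using g(1) by (intro sum_subtractf_nat) auto
      finally show ?thesis using g(2) \<alpha> by simp
    qed
    ultimately show "z \<in> subseq_sums \<alpha> AA" using ys(1) by (auto simp: subseq_sums_def)
  qed
  then have "card ((\<lambda>x. T - x) ` bounded_sums k a rs ((\<Sum>i=1..k. rs i) - \<alpha>)) \<le> card (subseq_sums \<alpha> AA)"
    using fin by (rule card_mono[rotated])
  then show ?thesis by (simp add: card_image inj_on_def)
qed

section \<open>Blocks of equal terms and the chain of large sums\<close>

lemma exists_block_index:
  fixes rs :: "nat \<Rightarrow> nat"
  assumes "n < (\<Sum>i=1..k. rs i)"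
  obtains m where "m \<in> {1..k}" "(\<Sum>i=1..m-1. rs i) \<le> n" "n < (\<Sum>i=1..m. rs i)"
proof -
  define m where "m = (LEAST m. n < (\<Sum>i=1..m. rs i))"
  have m: "n < (\<Sum>i=1..m. rs i)" unfolding m_def using assms by (rule LeastI)
  have "m \<le> k" unfolding m_def using assms by (rule Least_le)
  moreover have "m \<noteq> 0" using m by (cases m) auto
  moreover from this have "\<not> n < (\<Sum>i=1..m-1. rs i)" unfolding m_def using not_less_Least
    by (metis One_nat_def diff_Suc_less gr0I)
  ultimately show thesis using that[of m] m by auto
qed

text \<open>Number of terms with index \<open>i\<close> among the terms that remain when the \<open>\<alpha>\<close> smallest terms are removed.\<close>
definition top_mult :: "(nat \<Rightarrow> nat) \<Rightarrow> nat \<Rightarrow> nat \<Rightarrow> nat" where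
  "top_mult rs \<alpha> i = min (rs i) ((\<Sum>j=1..i. rs j) - \<alpha>)"

text \<open>The \<open>(n + 1)\<close>-st smallest term lies in block \<open>m\<close>: lower blocks
  are used up, higher ones untouched, and removing one more term costs one copy from block
  \<open>m\<close>.\<close>

lemma top_mult_eq:
  assumes m: "m \<ge> 1" "(\<Sum>i=1..m-1. rs i) \<le> n" "n < (\<Sum>i=1..m. rs i)" and i: "i \<ge> 1"
  shows "top_mult rs n i = (if i < m then 0 else if i = m then (\<Sum>i=1..m. rs i) - n else rs i)"
    and "top_mult rs n i = top_mult rs (Suc n) i + (if i = m then 1 else 0)"
proof -
  have mono: "(\<Sum>j=1..x. rs j) \<le> (\<Sum>j=1..y. rs j)" if "x \<le> y" for x y
    using that by (intro sum_mono2) auto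
  have Pi: "(\<Sum>j=1..i. rs j) = (\<Sum>j=1..i-1. rs j) + rs i" using i by (cases i) auto
  have Pm: "(\<Sum>j=1..m. rs j) = (\<Sum>j=1..m-1. rs j) + rs m" using m(1) by (cases m) auto
  consider "i < m" | "i = m" | "i > m" by linarith
  then have "top_mult rs n i = (if i < m then 0 else if i = m then (\<Sum>i=1..m. rs i) - n else rs i)
    \<and> top_mult rs n i = top_mult rs (Suc n) i + (if i = m then 1 else 0)"
  proof cases
    case 1
    then have "(\<Sum>j=1..i. rs j) \<le> n" using mono[of i "m - 1"] m(2) by linarith
    then show ?thesis using 1 by (simp add: top_mult_def del: One_nat_def)
  next
    case 2
    then show ?thesis using Pm m by (auto simp: top_mult_def)
  next
    case 3
    then have "Suc n \<le> (\<Sum>j=1..i-1. rs j)" using mono[of m "i - 1"] m(3) by linarith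
    then show ?thesis using 3 Pi by (simp add: top_mult_def del: One_nat_def)
  qed
  then show "top_mult rs n i = (if i < m then 0 else if i = m then (\<Sum>i=1..m. rs i) - n else rs i)"
    and "top_mult rs n i = top_mult rs (Suc n) i + (if i = m then 1 else 0)" by auto
qed

text \<open>Zero summands stand for absent terms, and \<open>r\<close> summands cannot exceed the
  caps \<open>rs i \<ge> r\<close>.\<close>

lemma hfold_sumset_subset_bounded_sums:
  assumes inj: "inj_on a {1..k}" and pos: "\<forall>i\<in>{1..k}. a i > 0"
    and le: "\<And>i. i \<in> {1..k} \<Longrightarrow> a i \<le> a k" and r: "\<And>i. i \<in> {1..k} \<Longrightarrow> r \<le> rs i"
    and k: "k \<ge> 1"
  shows "hfold_sumset r (a ` {1..k} \<union> {0}) \<subseteq> bounded_sums k a rs r \<inter> {..int r * a k}"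
proof
  fix z assume "z \<in> hfold_sumset r (a ` {1..k} \<union> {0})"
  then obtain xs where xs: "length xs = r" "set xs \<subseteq> insert 0 (a ` {1..k})" "z = sum_list xs"
    by (auto simp: hfold_sumset_def)
  define g where "g = (\<lambda>i. count_list xs (a i))"
  have zero: "0 \<notin> a ` {1..k}" using pos by auto
  have "r = (\<Sum>x\<in>insert 0 (a ` {1..k}). count_list xs x)" using xs(1,2) by (simp add: sum_count_set)
  then have "(\<Sum>x\<in>a ` {1..k}. count_list xs x) \<le> r" using zero by simp
  then have g: "(\<Sum>i=1..k. g i) \<le> r" using inj by (simp add: g_def sum.reindex)
  have "z = (\<Sum>x\<in>insert 0 (a ` {1..k}). int (count_list xs x) * x)"
    unfolding xs(3) using xs(2) by (intro sum_list_eq_sum_count) auto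
  then have z: "z = (\<Sum>i=1..k. int (g i) * a i)" using zero inj by (simp add: g_def sum.reindex)
  also have "\<dots> \<le> (\<Sum>i=1..k. int (g i) * a k)" using le by (intro sum_mono mult_left_mono) auto
  also have "\<dots> = int (\<Sum>i=1..k. g i) * a k" by (simp add: sum_distrib_right)
  also have "\<dots> \<le> int r * a k"
  proof (rule mult_right_mono)
    show "0 \<le> a k" using pos k by (simp add: less_imp_le)
  qed (use g in linarith)
  finally have "z \<le> int r * a k" .
  moreover have "g i \<le> rs i" if "i \<in> {1..k}" for i
    using r[OF that] count_le_length[of xs "a i"] xs(1) by (simp add: g_def)
  ultimately show "z \<in> bounded_sums k a rs r \<inter> {..int r * a k}"
    using z g by (auto simp: bounded_sums_def)
qed

text \<open>
  Starting from \<open>r\<close> copies of \<open>a k\<close>, the largest remaining terms are added one at a time, each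
  climbing through \<open>a 1 < a 2 < \<dots>\<close>; every step of a climb yields a new, larger sum.
\<close>
lemma card_bounded_sums_ge:
  fixes a :: "nat \<Rightarrow> int"
  assumes k: "k \<ge> 1" and pos: "\<forall>i\<in>{1..k}. a i > 0" and mono: "strict_mono_on {1..k} a"
    and r: "\<And>i. i \<in> {1..k} \<Longrightarrow> r \<le> rs i" "r > 0"
    and \<alpha>: "\<alpha> \<le> (\<Sum>i=1..k. rs i) - r"
  shows "int (card (hfold_sumset r (a ` {1..k} \<union> {0}))) + (\<Sum>i=1..k. int i * int (top_mult rs \<alpha> i)) - int k * int r
    \<le> int (card (bounded_sums k a rs ((\<Sum>i=1..k. rs i) - \<alpha>)))"
proof -
  define N where "N = (\<Sum>i=1..k. rs i)"
  define W where "W = (\<lambda>n. bounded_sums k a rs (N - n))"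
  define M where "M = (\<lambda>n. \<Sum>i=1..k. int (top_mult rs n i) * a i)"
  define \<Phi> where "\<Phi> = (\<lambda>n. \<Sum>i=1..k. int i * int (top_mult rs n i))"
  let ?H = "hfold_sumset r (a ` {1..k} \<union> {0})"
  have le: "a i \<le> a j" if "i \<in> {1..k}" "j \<in> {1..k}" "i \<le> j" for i j
    using that mono by (auto simp: strict_mono_on_def order_le_less)
  have inj: "inj_on a {1..k}" using mono by (rule strict_mono_on_imp_inj_on)
  have finW: "finite (W n)" for n unfolding W_def by (rule finite_bounded_sums[OF pos])
  have N_eq: "N = (\<Sum>i=1..k-1. rs i) + rs k" using k by (cases k) (auto simp: N_def)
  have rN: "r \<le> rs k" "r \<le> N" using r(1)[of k] k N_eq by auto
  \<comment> \<open>\<open>M n\<close> is the sum of the \<open>N - n\<close> largest terms.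
    Counting only up to \<open>M n\<close> keeps new elements apart from old ones; the induction
    descends from \<open>N - r\<close> to \<open>\<alpha>\<close>.\<close>
  have "(\<Sum>i=1..k. top_mult rs \<alpha> i) = N - \<alpha> \<and>
    int (card ?H) + \<Phi> \<alpha> - int k * int r \<le> int (card (W \<alpha> \<inter> {..M \<alpha>}))"
    using \<alpha>[folded N_def]
  proof (induction rule: inc_induct)
    case base
    \<comment> \<open>Since \<open>r \<le> rs k\<close>, the \<open>r\<close> largest terms are all
      copies of \<open>a k\<close>.\<close>
    have top: "top_mult rs (N - r) i = (if i = k then r else 0)" if "i \<in> {1..k}" for i
    proof (cases "i = k")
      case True
      then show ?thesis using rN by (simp add: top_mult_def N_def)
    next
      case False
      then have "(\<Sum>j=1..i. rs j) \<le> (\<Sum>j=1..k-1. rs j)" using that by (intro sum_mono2) auto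
      then show ?thesis using False rN N_eq by (simp add: top_mult_def)
    qed
    have "(\<Sum>i=1..k. top_mult rs (N - r) i) = (\<Sum>i=1..k. if i = k then r else 0)"
      using top by (intro sum.cong) auto
    then have 1: "(\<Sum>i=1..k. top_mult rs (N - r) i) = r" using k by simp
    have "M (N - r) = (\<Sum>i=1..k. if i = k then int r * a k else 0)"
      unfolding M_def using top by (intro sum.cong) auto
    then have 2: "M (N - r) = int r * a k" using k by simp
    have "\<Phi> (N - r) = (\<Sum>i=1..k. if i = k then int k * int r else 0)"
      unfolding \<Phi>_def using top by (intro sum.cong) auto
    then have 3: "\<Phi> (N - r) = int k * int r" using k by simp
    have "N - (N - r) = r" using rN by simp
    moreover have "?H \<subseteq> bounded_sums k a rs r \<inter> {..int r * a k}"
      by (rule hfold_sumset_subset_bounded_sums[OF inj pos _ r(1) k]) (use le k in auto)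
    ultimately have "?H \<subseteq> W (N - r) \<inter> {..M (N - r)}" by (simp only: W_def 2)
    then have "card ?H \<le> card (W (N - r) \<inter> {..M (N - r)})" using finW by (intro card_mono) auto
    then show ?case using 1 3 rN by simp
  next
    case (step n)
    then have "n < (\<Sum>i=1..k. rs i)" by (simp add: N_def)
    then obtain m where m: "m \<in> {1..k}" "(\<Sum>i=1..m-1. rs i) \<le> n" "n < (\<Sum>i=1..m. rs i)"
      by (rule exists_block_index)
    have m1: "m \<ge> 1" using m by simp
    note eq = top_mult_eq[OF m1 m(2,3)]
    have top: "top_mult rs n i = top_mult rs (Suc n) i + (if i = m then 1 else 0)" if "i \<in> {1..k}" for i
      using eq(2)[of i] that by simp
    have 1: "(\<Sum>i=1..k. top_mult rs n i) = N - n"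
    proof -
      have "(\<Sum>i=1..k. top_mult rs n i) = (\<Sum>i=1..k. top_mult rs (Suc n) i + (if i = m then 1 else 0))"
        using top by (intro sum.cong) auto
      also have "\<dots> = N - Suc n + 1" using step.IH m(1) by (simp add: sum.distrib)
      finally show ?thesis using step.hyps by simp
    qed
    have 2: "\<Phi> n = \<Phi> (Suc n) + int m"
    proof -
      have "\<Phi> n = (\<Sum>i=1..k. int i * int (top_mult rs (Suc n) i) + (if i = m then int m else 0))"
        unfolding \<Phi>_def using top by (intro sum.cong) (auto simp: algebra_simps)
      then show ?thesis using m(1) by (simp add: sum.distrib \<Phi>_def)
    qed
    have 3: "M n = M (Suc n) + a m"
    proof -
      have "M n = (\<Sum>i=1..k. int (top_mult rs (Suc n) i) * a i + (if i = m then a m else 0))"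
        unfolding M_def using top by (intro sum.cong) (auto simp: algebra_simps)
      then show ?thesis using m(1) by (simp add: sum.distrib M_def)
    qed
    \<comment> \<open>These are \<open>m\<close> values above \<open>M (Suc n)\<close> and up to
      \<open>M n\<close>, matching the increase of \<open>\<Phi>\<close>.\<close>
    define K where "K = (\<lambda>i. M (Suc n) + a i) ` {1..m}"
    have "K \<subseteq> W n \<inter> {..M n}"
    proof
      fix z assume "z \<in> K"
      then obtain i where i: "i \<in> {1..m}" "z = M (Suc n) + a i" by (auto simp: K_def)
      have ik: "i \<in> {1..k}" using i m by auto
      define g where "g = (\<lambda>j. top_mult rs (Suc n) j + (if j = i then 1 else 0))"
      have "(\<Sum>j=1..k. int (g j) * a j) = (\<Sum>j=1..k. int (top_mult rs (Suc n) j) * a j + (if j = i then a i else 0))"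
        unfolding g_def by (intro sum.cong) (auto simp: algebra_simps)
      then have z: "z = (\<Sum>j=1..k. int (g j) * a j)" using ik i(2) by (simp add: sum.distrib M_def)
      have "(\<Sum>j=1..k. g j) = N - Suc n + 1"
        unfolding g_def using step.IH ik by (simp add: sum.distrib)
      then have gsum: "(\<Sum>j=1..k. g j) \<le> N - n" using step.hyps by simp
      \<comment> \<open>Below block \<open>m\<close> no copy of \<open>a i\<close> is in use yet,
        and \<open>rs i \<ge> r > 0\<close>; for \<open>i = m\<close> the count is that of level
        \<open>n\<close>.\<close>
      have "g j \<le> rs j" if "j \<in> {1..k}" for j
      proof (cases "j = i")
        case True
        show ?thesis
        proof (cases "i = m")
          case False
          then have "top_mult rs (Suc n) i = 0" using eq(1)[of i] top[OF ik] i by simp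
          then show ?thesis using True r(1)[OF ik] r(2) by (simp add: g_def)
        next
          case im: True
          then have "g j = top_mult rs n m" using True top[OF ik] by (simp add: g_def)
          then show ?thesis using True im by (simp add: top_mult_def)
        qed
      qed (simp add: g_def top_mult_def)
      then have "z \<in> W n" unfolding W_def bounded_sums_def using z gsum by blast
      moreover have "z \<le> M n" using 3 i le[OF ik m(1)] by simp
      ultimately show "z \<in> W n \<inter> {..M n}" by simp
    qed
    moreover have "W (Suc n) \<inter> {..M (Suc n)} \<subseteq> W n \<inter> {..M n}"
    proof -
      have "W (Suc n) \<subseteq> W n" unfolding W_def bounded_sums_def by fastforce
      moreover have "M (Suc n) \<le> M n" using 3 pos m(1) by (simp add: less_imp_le)
      ultimately show ?thesis by auto
    qed
    ultimately have "card ((W (Suc n) \<inter> {..M (Suc n)}) \<union> K) \<le> card (W n \<inter> {..M n})"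
      using finW by (intro card_mono) auto
    moreover have "(W (Suc n) \<inter> {..M (Suc n)}) \<inter> K = {}" using pos m(1) by (force simp: K_def)
    moreover have "finite K" by (simp add: K_def)
    moreover have "card K = m"
    proof -
      have "inj_on a {1..m}" using inj_on_subset[OF inj, of "{1..m}"] m(1) by auto
      then have "inj_on (\<lambda>i. M (Suc n) + a i) {1..m}" by (metis (no_types, lifting) add_left_cancel inj_on_def)
      then show ?thesis by (simp add: K_def card_image)
    qed
    ultimately have "card (W (Suc n) \<inter> {..M (Suc n)}) + m \<le> card (W n \<inter> {..M n})"
      using finW by (simp add: card_Un_disjoint)
    then show ?case using 1 2 step.IH by simp
  qed
  moreover have "card (W \<alpha> \<inter> {..M \<alpha>}) \<le> card (W \<alpha>)" using finW by (intro card_mono) auto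
  ultimately show ?thesis unfolding W_def \<Phi>_def N_def by linarith
qed

section \<open>Combination of complements, chain and Lev's inequality\<close>

theorem theorem6p2:
  fixes k \<alpha> r :: nat and a :: "nat \<Rightarrow> int" and rs :: "nat \<Rightarrow> nat"
    and AA :: "int list" and A :: "int set"
  assumes "k \<ge> 3"
    and "seq_with_mult k a rs AA"
    and "\<forall>i\<in>{1..k}. a i > 0"
    and "strict_mono_on {1..k} a"
    and "\<forall>i\<in>{1..k}. rs i \<ge> 2"
    and "A = a ` {1..k}"
    and "r = Min (rs ` {1..k})"
    and "Gcd A = 1"
    and "\<alpha> > 0"
    and "int \<alpha> < (\<Sum>i=1..k. int (rs i)) - int r"
  shows "\<exists>m\<in>{1..k}.
      (\<Sum>i=1..m-1. rs i) \<le> \<alpha> \<and> \<alpha> < (\<Sum>i=1..m. rs i) \<and>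
      int (card (subseq_sums \<alpha> AA)) \<ge>
        int (card (hfold_sumset (r - 1) (A \<union> {0})))
        + min (a k) (int r * (int k - 1) + 1)
        + (\<Sum>i=1..k-1. int i * int (rs i))
        - (\<Sum>i=1..m. int i * int (rs i))
        + int m * ((\<Sum>i=1..m. int (rs i)) - int \<alpha>)
        + int k * (int (rs k) - int r)"
proof -
  define N where "N = (\<Sum>i=1..k. rs i)"
  have k: "k \<ge> 1" "k \<in> {1..k}" using assms(1) by auto
  have r: "r \<le> rs i" if "i \<in> {1..k}" for i using that assms(7) by (simp add: Min_le)
  have r2: "r \<ge> 2"
  proof -
    have "r \<in> rs ` {1..k}" unfolding assms(7) using k by (intro Min_in) auto
    then show ?thesis using assms(5) by auto
  qed
  have "int N = (\<Sum>i=1..k. int (rs i))" by (simp add: N_def)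
  then have \<alpha>: "\<alpha> + r < N" using assms(10) by linarith
  then have "\<alpha> < (\<Sum>i=1..k. rs i)" by (simp add: N_def)
  then obtain m where m: "m \<in> {1..k}" "(\<Sum>i=1..m-1. rs i) \<le> \<alpha>" "\<alpha> < (\<Sum>i=1..m. rs i)"
    by (rule exists_block_index)
  have inj: "inj_on a {1..k}" using assms(4) by (rule strict_mono_on_imp_inj_on)
  have le: "a i \<le> a k" if "i \<in> {1..k}" for i
    using that k assms(4) by (cases "i = k") (auto simp: strict_mono_on_def order_le_less)
  have zero: "0 \<notin> A" using assms(3,6) by auto
  have cardA: "card (A \<union> {0}) = k + 1" using zero inj assms(6) by (simp add: card_image)
  have lev: "int (card (hfold_sumset (r - 1) (A \<union> {0}))) + min (a k) (int r * (int (card (A \<union> {0})) - 2) + 1)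
    \<le> int (card (hfold_sumset r (A \<union> {0})))"
  proof (rule card_hfold_sumset_growth)
    show "A \<union> {0} \<subseteq> {0..a k}" using assms(3,6) le k by (auto simp: less_imp_le)
    show "a k \<in> A \<union> {0}" "a k > 0" using assms(3,6) k by auto
    show "Gcd (A \<union> {0}) = 1" using assms(8) by simp
  qed (use r2 in auto)
  have chain: "int (card (hfold_sumset r (A \<union> {0}))) + (\<Sum>i=1..k. int i * int (top_mult rs \<alpha> i)) - int k * int r
    \<le> int (card (bounded_sums k a rs (N - \<alpha>)))"
    unfolding assms(6) N_def
    using k(1) assms(3,4) r r2 \<alpha> by (intro card_bounded_sums_ge) (auto simp: N_def)
  have compl: "card (bounded_sums k a rs (N - \<alpha>)) \<le> card (subseq_sums \<alpha> AA)"
    unfolding N_def using assms(2) \<alpha> by (intro card_bounded_sums_le) (auto simp: N_def)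
  \<comment> \<open>Blocks below \<open>m\<close> contribute nothing, block \<open>m\<close> its
    remaining terms, later blocks everything.\<close>
  have top: "(\<Sum>i=1..k. int i * int (top_mult rs \<alpha> i)) + (\<Sum>i=1..m. int i * int (rs i))
    = (\<Sum>i=1..k. int i * int (rs i)) + int m * ((\<Sum>i=1..m. int (rs i)) - int \<alpha>)"
  proof -
    have "int i * int (top_mult rs \<alpha> i) + (if i \<le> m then int i * int (rs i) else 0)
      = int i * int (rs i) + (if i = m then int m * ((\<Sum>i=1..m. int (rs i)) - int \<alpha>) else 0)"
      if "i \<in> {1..k}" for i
      using top_mult_eq(1)[of m rs \<alpha> i] m that by (auto simp: of_nat_diff)
    then have "(\<Sum>i=1..k. int i * int (top_mult rs \<alpha> i) + (if i \<le> m then int i * int (rs i) else 0))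
      = (\<Sum>i=1..k. int i * int (rs i) + (if i = m then int m * ((\<Sum>i=1..m. int (rs i)) - int \<alpha>) else 0))"
      by (intro sum.cong) auto
    moreover have "(\<Sum>i=1..k. if i \<le> m then int i * int (rs i) else 0) = (\<Sum>i=1..m. int i * int (rs i))"
      using m(1) by (intro sum.mono_neutral_cong_right) auto
    ultimately show ?thesis using m(1) by (simp add: sum.distrib)
  qed
  \<comment> \<open>The last block, less the \<open>k * r\<close> subtracted in
    \<open>chain\<close>, yields \<open>k * (rs k - r)\<close>.\<close>
  have last: "(\<Sum>i=1..k. int i * int (rs i)) = (\<Sum>i=1..k-1. int i * int (rs i)) + int k * int (rs k)"
    using k by (cases k) auto
  have "int k * (int (rs k) - int r) = int k * int (rs k) - int k * int r" by (simp add: algebra_simps)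
  then have "int (card (hfold_sumset (r - 1) (A \<union> {0})))
        + min (a k) (int r * (int k - 1) + 1)
        + (\<Sum>i=1..k-1. int i * int (rs i))
        - (\<Sum>i=1..m. int i * int (rs i))
        + int m * ((\<Sum>i=1..m. int (rs i)) - int \<alpha>)
        + int k * (int (rs k) - int r) \<le> int (card (subseq_sums \<alpha> AA))"
    using lev chain compl top last unfolding cardA by simp
  then show ?thesis using m by blast
qed

end
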